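(* For a cardinal $\kappa$ the following are equivalent: (1) $\kappa$ is second-order reflective; (2) $\kappa$ is reflective for $\Pi^1_1$ assertions; (3) $\kappa$ is a supercompact cardinal.
   Context: Work in $\mathsf{ZFC}$. A cardinal $\kappa$ is second-order reflective if every second-order sentence $\varphi$ true in some structure $M$ (of any size) with $\kappa\subseteq M$, in a language of size less than $\kappa$, is also true in a first-order elementary substructure $m\prec M$ of size less than $\kappa$ with $m\cap\kappa\in\kappa$. Second-order truth is with full semantics (second-order quantifiers range over all subsets of, and relations on, the domain). The cardinal $\kappa$ is reflective for $\Pi^1_1$ assertions if this holds for all sentences $\varphi$ of complexity $\Pi^1_1$ (universal second-order quantifiers followed by a first-order formula). *)

theory Defs
  imports "HOL-Library.Equipollence" "HOL-Library.FuncSet" "HOL-Library.NList"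
begin

section \<open>The set-theoretic universe\<close>

text \<open>
  The axioms of ZFC for a membership relation on a type. Separation and Replacement are stated for
  arbitrary HOL predicates and functions, so every subcollection of (the elements of) a set is
  again a set. Hence subsets of a set, relations on a set, and families of such may be represented
  by HOL sets over the type without changing their meaning. The axiom of Choice
  follows from the choice operator of HOL together with Separation.
\<close>

class zfc_universe =
  fixes elts :: "'a \<Rightarrow> 'a set"
  assumes extensionality: "elts x = elts y \<Longrightarrow> x = y"
    and foundation: "elts x \<noteq> {} \<Longrightarrow> \<exists>y\<in>elts x. elts y \<inter> elts x = {}"
    and pairing: "\<exists>z. elts z = {x, y}"
    and union: "\<exists>y. elts y = (\<Union>z\<in>elts x. elts z)"
    and power_set: "\<exists>y. elts y = {z. elts z \<subseteq> elts x}"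
    and infinity: "\<exists>y. (\<exists>z\<in>elts y. elts z = {}) \<and>
                       (\<forall>z\<in>elts y. \<exists>w\<in>elts y. elts w = insert z (elts z))"
    and separation: "\<exists>y. elts y = {z \<in> elts x. P z}"
    and replacement: "\<exists>y. elts y = f ` elts x"

definition transitive_set :: "'v::zfc_universe \<Rightarrow> bool" where
  "transitive_set x \<longleftrightarrow> (\<forall>y\<in>elts x. elts y \<subseteq> elts x)"

definition ordinal :: "'v::zfc_universe \<Rightarrow> bool" where
  "ordinal \<alpha> \<longleftrightarrow> transitive_set \<alpha> \<and> (\<forall>\<beta>\<in>elts \<alpha>. transitive_set \<beta>)"

definition cardinal :: "'v::zfc_universe \<Rightarrow> bool" where
  "cardinal \<kappa> \<longleftrightarrow> ordinal \<kappa> \<and> (\<forall>\<alpha>\<in>elts \<kappa>. elts \<alpha> \<prec> elts \<kappa>)"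

section \<open>Second-order logic\<close>

text \<open>
  Symbols of a language are elements of the universe. Function symbols of arity 0 are the constant
  symbols.
\<close>

record 's language =
  funs :: "'s set"
  rels :: "'s set"
  fun_arity :: "'s \<Rightarrow> nat"
  rel_arity :: "'s \<Rightarrow> nat"

definition symbols :: "'s language \<Rightarrow> ('s + 's) set" where
  "symbols L = funs L <+> rels L"

datatype 's tm = Var nat | Fn 's "'s tm list"

text \<open>
  A second-order variable is identified by its arity \<open>n\<close> and an index \<open>i\<close>. In
  \<open>RelVar i ts\<close> the arity is \<open>length ts\<close>.
\<close>

datatype 's fm =
    Eq "'s tm" "'s tm"
  | Rel 's "'s tm list"
  | RelVar nat "'s tm list"
  | Neg "'s fm"
  | And "'s fm" "'s fm"
  | All nat "'s fm"
  | All2 nat nat "'s fm"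

primrec tm_of :: "'s language \<Rightarrow> 's tm \<Rightarrow> bool" where
  "tm_of L (Var x) \<longleftrightarrow> True"
| "tm_of L (Fn f ts) \<longleftrightarrow> f \<in> funs L \<and> length ts = fun_arity L f \<and> list_all (\<lambda>b. b) (map (tm_of L) ts)"

primrec fm_of :: "'s language \<Rightarrow> 's fm \<Rightarrow> bool" where
  "fm_of L (Eq s t) \<longleftrightarrow> tm_of L s \<and> tm_of L t"
| "fm_of L (Rel r ts) \<longleftrightarrow> r \<in> rels L \<and> length ts = rel_arity L r \<and> (\<forall>t\<in>set ts. tm_of L t)"
| "fm_of L (RelVar i ts) \<longleftrightarrow> (\<forall>t\<in>set ts. tm_of L t)"
| "fm_of L (Neg \<phi>) \<longleftrightarrow> fm_of L \<phi>"
| "fm_of L (And \<phi> \<psi>) \<longleftrightarrow> fm_of L \<phi> \<and> fm_of L \<psi>"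
| "fm_of L (All x \<phi>) \<longleftrightarrow> fm_of L \<phi>"
| "fm_of L (All2 n i \<phi>) \<longleftrightarrow> fm_of L \<phi>"

primrec tm_vars :: "'s tm \<Rightarrow> nat set" where
  "tm_vars (Var x) = {x}"
| "tm_vars (Fn f ts) = \<Union> (set (map tm_vars ts))"

primrec free_vars :: "'s fm \<Rightarrow> nat set" where
  "free_vars (Eq s t) = tm_vars s \<union> tm_vars t"
| "free_vars (Rel r ts) = (\<Union>t\<in>set ts. tm_vars t)"
| "free_vars (RelVar i ts) = (\<Union>t\<in>set ts. tm_vars t)"
| "free_vars (Neg \<phi>) = free_vars \<phi>"
| "free_vars (And \<phi> \<psi>) = free_vars \<phi> \<union> free_vars \<psi>"
| "free_vars (All x \<phi>) = free_vars \<phi> - {x}"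
| "free_vars (All2 n i \<phi>) = free_vars \<phi>"

primrec free_vars2 :: "'s fm \<Rightarrow> (nat \<times> nat) set" where
  "free_vars2 (Eq s t) = {}"
| "free_vars2 (Rel r ts) = {}"
| "free_vars2 (RelVar i ts) = {(length ts, i)}"
| "free_vars2 (Neg \<phi>) = free_vars2 \<phi>"
| "free_vars2 (And \<phi> \<psi>) = free_vars2 \<phi> \<union> free_vars2 \<psi>"
| "free_vars2 (All x \<phi>) = free_vars2 \<phi>"
| "free_vars2 (All2 n i \<phi>) = free_vars2 \<phi> - {(n, i)}"

definition sentence_of :: "'s language \<Rightarrow> 's fm \<Rightarrow> bool" where
  "sentence_of L \<phi> \<longleftrightarrow> fm_of L \<phi> \<and> free_vars \<phi> = {} \<and> free_vars2 \<phi> = {}"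

text \<open>No second-order quantifiers, but possibly free second-order variables.\<close>

primrec no_quant2 :: "'s fm \<Rightarrow> bool" where
  "no_quant2 (Eq s t) \<longleftrightarrow> True"
| "no_quant2 (Rel r ts) \<longleftrightarrow> True"
| "no_quant2 (RelVar i ts) \<longleftrightarrow> True"
| "no_quant2 (Neg \<phi>) \<longleftrightarrow> no_quant2 \<phi>"
| "no_quant2 (And \<phi> \<psi>) \<longleftrightarrow> no_quant2 \<phi> \<and> no_quant2 \<psi>"
| "no_quant2 (All x \<phi>) \<longleftrightarrow> no_quant2 \<phi>"
| "no_quant2 (All2 n i \<phi>) \<longleftrightarrow> False"

definition first_order :: "'s fm \<Rightarrow> bool" where
  "first_order \<phi> \<longleftrightarrow> no_quant2 \<phi> \<and> free_vars2 \<phi> = {}"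

inductive pi11 :: "'s fm \<Rightarrow> bool" where
  matrix: "no_quant2 \<phi> \<Longrightarrow> pi11 \<phi>"
| all2: "pi11 \<phi> \<Longrightarrow> pi11 (All2 n i \<phi>)"

text \<open>
  The domain is a set of the universe. Relations are sets of tuples, and \<open>nlists n A\<close> is the
  collection of n-tuples over \<open>A\<close>.
\<close>

record 'v struct =
  domain :: 'v
  fun_int :: "'v \<Rightarrow> 'v list \<Rightarrow> 'v"
  rel_int :: "'v \<Rightarrow> 'v list set"

abbreviation points :: "'v::zfc_universe struct \<Rightarrow> 'v set" where
  "points M \<equiv> elts (domain M)"

definition structure_of :: "'v::zfc_universe language \<Rightarrow> 'v struct \<Rightarrow> bool" where
  "structure_of L M \<longleftrightarrow>
     points M \<noteq> {} \<and>
     (\<forall>f\<in>funs L. \<forall>xs\<in>nlists (fun_arity L f) (points M). fun_int M f xs \<in> points M) \<and>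
     (\<forall>r\<in>rels L. rel_int M r \<subseteq> nlists (rel_arity L r) (points M))"

primrec tm_val :: "'v struct \<Rightarrow> (nat \<Rightarrow> 'v) \<Rightarrow> 'v tm \<Rightarrow> 'v" where
  "tm_val M e (Var x) = e x"
| "tm_val M e (Fn f ts) = fun_int M f (map (tm_val M e) ts)"

primrec sat :: "'v::zfc_universe struct \<Rightarrow> (nat \<Rightarrow> 'v) \<Rightarrow> (nat \<times> nat \<Rightarrow> 'v list set) \<Rightarrow> 'v fm \<Rightarrow> bool"
where
  "sat M e S (Eq s t) \<longleftrightarrow> tm_val M e s = tm_val M e t"
| "sat M e S (Rel r ts) \<longleftrightarrow> map (tm_val M e) ts \<in> rel_int M r"
| "sat M e S (RelVar i ts) \<longleftrightarrow> map (tm_val M e) ts \<in> S (length ts, i)"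
| "sat M e S (Neg \<phi>) \<longleftrightarrow> \<not> sat M e S \<phi>"
| "sat M e S (And \<phi> \<psi>) \<longleftrightarrow> sat M e S \<phi> \<and> sat M e S \<psi>"
| "sat M e S (All x \<phi>) \<longleftrightarrow> (\<forall>a\<in>points M. sat M (e(x := a)) S \<phi>)"
| "sat M e S (All2 n i \<phi>) \<longleftrightarrow> (\<forall>R\<subseteq>nlists n (points M). sat M e (S((n, i) := R)) \<phi>)"

definition true_in :: "'v::zfc_universe fm \<Rightarrow> 'v struct \<Rightarrow> bool" where
  "true_in \<phi> M \<longleftrightarrow>
     (\<forall>e S. range e \<subseteq> points M \<and> (\<forall>n i. S (n, i) \<subseteq> nlists n (points M)) \<longrightarrow> sat M e S \<phi>)"

definition substructure :: "'v::zfc_universe language \<Rightarrow> 'v struct \<Rightarrow> 'v struct \<Rightarrow> bool" where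
  "substructure L m M \<longleftrightarrow>
     structure_of L m \<and> points m \<subseteq> points M \<and>
     (\<forall>f\<in>funs L. \<forall>xs\<in>nlists (fun_arity L f) (points m). fun_int m f xs = fun_int M f xs) \<and>
     (\<forall>r\<in>rels L. rel_int m r = rel_int M r \<inter> nlists (rel_arity L r) (points m))"

definition elementary_substructure ::
  "'v::zfc_universe language \<Rightarrow> 'v struct \<Rightarrow> 'v struct \<Rightarrow> bool" where
  "elementary_substructure L m M \<longleftrightarrow>
     substructure L m M \<and>
     (\<forall>\<phi> e S. fm_of L \<phi> \<and> first_order \<phi> \<and> range e \<subseteq> points m \<longrightarrow> sat m e S \<phi> = sat M e S \<phi>)"

section \<open>Reflective cardinals\<close>

definition reflective_for :: "('v::zfc_universe fm \<Rightarrow> bool) \<Rightarrow> 'v \<Rightarrow> bool" where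
  "reflective_for \<Gamma> \<kappa> \<longleftrightarrow>
     (\<forall>L M \<phi>. symbols L \<prec> elts \<kappa> \<and> structure_of L M \<and> elts \<kappa> \<subseteq> points M \<and>
        sentence_of L \<phi> \<and> \<Gamma> \<phi> \<and> true_in \<phi> M \<longrightarrow>
        (\<exists>m. elementary_substructure L m M \<and> points m \<prec> elts \<kappa> \<and>
             (\<exists>\<alpha>\<in>elts \<kappa>. points m \<inter> elts \<kappa> = elts \<alpha>) \<and> true_in \<phi> m))"

definition second_order_reflective :: "'v::zfc_universe \<Rightarrow> bool" where
  "second_order_reflective \<kappa> \<longleftrightarrow> reflective_for (\<lambda>_. True) \<kappa>"

definition pi11_reflective :: "'v::zfc_universe \<Rightarrow> bool" where
  "pi11_reflective \<kappa> \<longleftrightarrow> reflective_for pi11 \<kappa>"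

section \<open>Supercompact cardinals\<close>

definition small_subsets :: "'v::zfc_universe \<Rightarrow> 'v \<Rightarrow> 'v set set" where
  "small_subsets \<kappa> A = {x. x \<subseteq> elts A \<and> x \<prec> elts \<kappa>}"

definition ultrafilter_on :: "'b set \<Rightarrow> 'b set set \<Rightarrow> bool" where
  "ultrafilter_on P U \<longleftrightarrow>
     U \<subseteq> Pow P \<and> P \<in> U \<and> {} \<notin> U \<and>
     (\<forall>X\<in>U. \<forall>Y. X \<subseteq> Y \<and> Y \<subseteq> P \<longrightarrow> Y \<in> U) \<and>
     (\<forall>X\<in>U. \<forall>Y\<in>U. X \<inter> Y \<in> U) \<and>
     (\<forall>X\<subseteq>P. X \<in> U \<or> P - X \<in> U)"

definition complete_family :: "'v::zfc_universe \<Rightarrow> 'b set set \<Rightarrow> bool" where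
  "complete_family \<kappa> U \<longleftrightarrow> (\<forall>\<F>\<subseteq>U. \<F> \<noteq> {} \<and> \<F> \<prec> elts \<kappa> \<longrightarrow> \<Inter>\<F> \<in> U)"

definition fine_measure :: "'v::zfc_universe \<Rightarrow> 'v \<Rightarrow> 'v set set set \<Rightarrow> bool" where
  "fine_measure \<kappa> A U \<longleftrightarrow>
     ultrafilter_on (small_subsets \<kappa> A) U \<and> complete_family \<kappa> U \<and>
     (\<forall>a\<in>elts A. {x \<in> small_subsets \<kappa> A. a \<in> x} \<in> U)"

definition normal_measure :: "'v::zfc_universe \<Rightarrow> 'v \<Rightarrow> 'v set set set \<Rightarrow> bool" where
  "normal_measure \<kappa> A U \<longleftrightarrow>
     fine_measure \<kappa> A U \<and>
     (\<forall>f \<in> small_subsets \<kappa> A \<rightarrow> elts A. {x \<in> small_subsets \<kappa> A. f x \<in> x} \<in> U \<longrightarrow>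
        (\<exists>a\<in>elts A. {x \<in> small_subsets \<kappa> A. f x = a} \<in> U))"

text \<open>
  Supercompactness in its first-order form (Solovay--Reinhardt--Kanamori; the definition in Jech,
  Set Theory): no quantification over class embeddings of the universe is needed.
\<close>

definition supercompact :: "'v::zfc_universe \<Rightarrow> bool" where
  "supercompact \<kappa> \<longleftrightarrow>
     cardinal \<kappa> \<and> uncountable (elts \<kappa>) \<and>
     (\<forall>A. elts \<kappa> \<lesssim> elts A \<longrightarrow> (\<exists>U. normal_measure \<kappa> A U))"

end

theory Submission
  imports Defs "HOL-Library.Countable_Set"
begin

text \<open>
  From a normal measure on the small subsets of the domain of a structure \<open>M\<close>, one proves a
  theorem of Los for full second-order formulas: \<open>M\<close> satisfies a formula iff almost every
  restriction \<open>M|x\<close> does, with relations restricted to \<open>x\<close>. The step for second-order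
  quantifiers is that counterexamples \<open>R\<^sub>x\<close> on \<open>x\<close> agree for almost every \<open>x\<close> with the restriction
  of a single relation, namely the tuples that lie in almost every \<open>R\<^sub>x\<close>; otherwise, normality would
  fix one tuple on which they disagree.

  Conversely, suppose that there is no normal measure on the family \<open>P\<close> of small subsets of \<open>A\<close>. Take
  a domain containing codes for all subsets of \<open>P\<close> and all families of these, with Skolem functions
  that send (the code of) a family \<open>U\<close> to witnesses that \<open>U\<close> is not a normal measure. That every set of
  coded subsets of \<open>P\<close> is itself coded is a \<open>\<Pi>\<^sup>1\<^sub>1\<close> assertion, so it holds in a small substructure
  \<open>m\<close>; hence \<open>m\<close> has a code for the family of all \<open>X\<close> coded in \<open>m\<close> with \<open>m \<inter> A \<in> X\<close>. This
  family behaves like a normal measure on the sets coded in \<open>m\<close>, and the witnesses are in \<open>m\<close>.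
\<close>

text \<open>As a simplification rule it loops as soon as \<open>nlists\<close> is unfolded.\<close>

declare nlistsE_set [simp del]

section \<open>Cardinalities\<close>

lemma countable_lesspoll_uncountable:
  assumes "countable A" "uncountable B"
  shows "A \<prec> B"
proof -
  have "A \<lesssim> (UNIV :: nat set)"
    using assms(1) unfolding countable_def lepoll_def by blast
  moreover have "infinite B"
    using assms(2) by (auto intro: countable_finite)
  then have "(UNIV :: nat set) \<lesssim> B"
    by (simp add: infinite_le_lepoll)
  ultimately have "A \<lesssim> B"
    by (rule lepoll_trans)
  moreover have "\<not> A \<approx> B"
    using assms countable_eqpoll[OF assms(1) eqpoll_sym] by auto
  ultimately show ?thesis
    by (simp add: lesspoll_def)
qed

lemma insert_lesspoll_uncountable:
  assumes "I \<prec> B" "uncountable B"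
  shows "insert c I \<prec> B"
proof (cases "finite I")
  case True
  then show ?thesis
    using assms(2) by (intro countable_lesspoll_uncountable) (auto intro: countable_finite)
next
  case False
  then have "insert c I \<lesssim> I"
    by (intro eqpoll_imp_lepoll infinite_insert_eqpoll)
  then show ?thesis
    using assms(1) by (rule lesspoll_trans1)
qed

text \<open>Padding with the default \<open>c\<close> makes every tuple a part of an infinite
  sequence. Normality for tuples will thus follow from normality for sequences.\<close>

lemma nlists_as_sequences: "nlists n X \<subseteq> (\<lambda>g. map g [0..<n]) ` {g. \<forall>k. g k \<in> insert c X}"
proof
  fix xs assume xs: "xs \<in> nlists n X"
  define g where "g k = (if k < n then xs ! k else c)" for k
  have "xs = map g [0..<n]"
    using xs by (intro nth_equalityI) (auto simp: g_def)
  moreover have "\<forall>k. g k \<in> insert c X"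
    using xs by (simp add: g_def nlistsE_nth_in)
  ultimately show "xs \<in> (\<lambda>g. map g [0..<n]) ` {g. \<forall>k. g k \<in> insert c X}"
    by blast
qed

section \<open>Ordinals\<close>

lemma ordinal_induct [consumes 2, case_names less]:
  assumes "ordinal \<kappa>" "\<alpha> \<in> elts \<kappa>"
    and less: "\<And>\<alpha>. \<alpha> \<in> elts \<kappa> \<Longrightarrow> (\<And>\<beta>. \<beta> \<in> elts \<alpha> \<Longrightarrow> Q \<beta>) \<Longrightarrow> Q \<alpha>"
  shows "Q \<alpha>"
proof (rule ccontr)
  assume "\<not> Q \<alpha>"
  \<comment> \<open>Separation makes the counterexamples a set, so that Foundation yields a minimal
    one.\<close>
  obtain y where y: "elts y = {z \<in> elts \<kappa>. \<not> Q z}"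
    using separation[of \<kappa> "\<lambda>z. \<not> Q z"] by blast
  then have "elts y \<noteq> {}"
    using assms(2) \<open>\<not> Q \<alpha>\<close> by blast
  then obtain z where z: "z \<in> elts y" "elts z \<inter> elts y = {}"
    using foundation by blast
  then have "elts z \<subseteq> elts \<kappa>"
    using y assms(1) by (auto simp: ordinal_def transitive_set_def)
  have "Q z"
  proof (rule less)
    show "z \<in> elts \<kappa>"
      using z(1) y by blast
  next
    fix \<beta> assume "\<beta> \<in> elts z"
    then have "\<beta> \<in> elts \<kappa>" "\<beta> \<notin> elts y"
      using \<open>elts z \<subseteq> elts \<kappa>\<close> z(2) by blast+
    then show "Q \<beta>"
      using y by blast
  qed
  then show False
    using z y by auto
qed

text \<open>Nested inductions on \<alpha> and \<beta>: when all smaller pairs are comparable,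
  incomparable \<alpha> and \<beta> would have the same elements.\<close>

lemma ordinal_linear:
  assumes \<kappa>: "ordinal \<kappa>" and "\<alpha> \<in> elts \<kappa>" "\<beta> \<in> elts \<kappa>"
  shows "\<alpha> = \<beta> \<or> \<alpha> \<in> elts \<beta> \<or> \<beta> \<in> elts \<alpha>"
  using assms
proof (induction arbitrary: \<beta> rule: ordinal_induct)
  case (less \<alpha>)
  note outer = less
  show ?case
    using \<kappa> \<open>\<beta> \<in> elts \<kappa>\<close>
  proof (induction rule: ordinal_induct)
    case (less \<beta>)
    show ?case
    proof (rule ccontr)
      assume incomparable: "\<not> ?case"
      have trans: "elts \<delta> \<subseteq> elts \<gamma>" if "\<gamma> \<in> elts \<kappa>" "\<delta> \<in> elts \<gamma>" for \<gamma> \<delta>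
        using \<kappa> that by (auto simp: ordinal_def transitive_set_def)
      have "elts \<alpha> = elts \<beta>"
      proof (intro set_eqI iffI)
        fix \<gamma> assume \<gamma>: "\<gamma> \<in> elts \<alpha>"
        then have "\<gamma> = \<beta> \<or> \<gamma> \<in> elts \<beta> \<or> \<beta> \<in> elts \<gamma>"
          using outer(2) less.hyps by blast
        then show "\<gamma> \<in> elts \<beta>"
          using incomparable trans[OF outer(1) \<gamma>] \<gamma> by blast
      next
        fix \<gamma> assume \<gamma>: "\<gamma> \<in> elts \<beta>"
        then have "\<alpha> = \<gamma> \<or> \<alpha> \<in> elts \<gamma> \<or> \<gamma> \<in> elts \<alpha>"
          using less.IH by blast
        then show "\<gamma> \<in> elts \<alpha>"
          using incomparable trans[OF less.hyps \<gamma>] \<gamma> by blast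
      qed
      then show False
        using extensionality incomparable by blast
    qed
  qed
qed

text \<open>Otherwise induction puts every \<alpha> of \<kappa> into X: once the elements of
  \<alpha> lie in X, some \<beta> in X lies outside \<alpha>; it equals \<alpha> or has \<alpha> as
  an element, and in both cases \<alpha> is in X.\<close>

lemma initial_segment_of_ordinal:
  assumes \<kappa>: "ordinal \<kappa>" and X: "X \<subseteq> elts \<kappa>" "X \<noteq> elts \<kappa>"
    and closed: "\<And>\<beta>. \<beta> \<in> X \<Longrightarrow> elts \<beta> \<subseteq> X"
  shows "\<exists>\<alpha>\<in>elts \<kappa>. X = elts \<alpha>"
proof (rule ccontr)
  assume contra: "\<not> ?thesis"
  have "\<alpha> \<in> X" if "\<alpha> \<in> elts \<kappa>" for \<alpha>
    using \<kappa> that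
  proof (induction rule: ordinal_induct)
    case (less \<alpha>)
    then obtain \<beta> where \<beta>: "\<beta> \<in> X" "\<beta> \<notin> elts \<alpha>"
      using contra by blast
    then show ?case
      using ordinal_linear[OF \<kappa> less.hyps, of \<beta>] closed[of \<beta>] X(1) by blast
  qed
  then show False
    using X by blast
qed

text \<open>If no \<gamma> in \<kappa> is large enough, elements of X not yet used can be picked
  along all of \<kappa>, which injects \<kappa> into X. The lemma later indexes families smaller
  than \<kappa> by ordinals below \<kappa>.\<close>

lemma lesspoll_ordinal:
  assumes \<kappa>: "ordinal \<kappa>" and X: "X \<prec> elts \<kappa>"
  shows "\<exists>\<gamma>\<in>elts \<kappa>. X \<lesssim> elts \<gamma>"
proof (rule ccontr)
  assume contra: "\<not> ?thesis"
  define r where "r = {(\<beta>, \<alpha>). \<alpha> \<in> elts \<kappa> \<and> \<beta> \<in> elts \<alpha>}"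
  have "wf r"
    unfolding wf_def
  proof (intro allI impI)
    fix Q and \<alpha> :: 'a assume step: "\<forall>\<alpha>. (\<forall>\<beta>. (\<beta>, \<alpha>) \<in> r \<longrightarrow> Q \<beta>) \<longrightarrow> Q \<alpha>"
    have Q: "Q \<alpha>" if "\<alpha> \<in> elts \<kappa>" for \<alpha>
      using \<kappa> that
    proof (induction rule: ordinal_induct)
      case (less \<alpha>)
      then show ?case
        using step[rule_format, of \<alpha>] by (simp add: r_def)
    qed
    show "Q \<alpha>"
    proof (cases "\<alpha> \<in> elts \<kappa>")
      case False
      then show ?thesis
        using step[rule_format, of \<alpha>] by (simp add: r_def)
    qed (rule Q)
  qed
  \<comment> \<open>At stage \<alpha> the recursion picks an element of X that no earlier stage has
    picked.\<close>
  define i where "i = wfrec r (\<lambda>i \<alpha>. SOME x. x \<in> X - i ` elts \<alpha>)"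
  have i: "i \<alpha> \<in> X - i ` elts \<alpha>" if \<alpha>: "\<alpha> \<in> elts \<kappa>" for \<alpha>
  proof -
    have "cut i r \<alpha> ` elts \<alpha> = i ` elts \<alpha>"
      using \<alpha> by (intro image_cong refl cut_apply) (simp add: r_def)
    then have eq: "i \<alpha> = (SOME x. x \<in> X - i ` elts \<alpha>)"
      using wfrec[OF \<open>wf r\<close>, of "\<lambda>i \<alpha>. SOME x. x \<in> X - i ` elts \<alpha>" \<alpha>]
      unfolding i_def[symmetric] by simp
    have "\<not> X \<subseteq> i ` elts \<alpha>"
      using contra \<alpha> subset_image_lepoll by blast
    then have "\<exists>x. x \<in> X - i ` elts \<alpha>"
      by blast
    then show ?thesis
      unfolding eq by (rule someI_ex)
  qed
  have "inj_on i (elts \<kappa>)"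
  proof (rule inj_onI, rule ccontr)
    fix \<alpha> \<beta> assume "\<alpha> \<in> elts \<kappa>" "\<beta> \<in> elts \<kappa>" "i \<alpha> = i \<beta>" "\<alpha> \<noteq> \<beta>"
    then show False
      using ordinal_linear[OF \<kappa>, of \<alpha> \<beta>] i[of \<alpha>] i[of \<beta>] by (metis Diff_iff imageI)
  qed
  moreover have "i ` elts \<kappa> \<subseteq> X"
    using i by blast
  ultimately have "elts \<kappa> \<lesssim> X"
    unfolding lepoll_def by blast
  then show False
    using X lesspoll_trans2 lesspoll_not_refl by blast
qed

section \<open>Formulas over a small language\<close>

instance tm :: (countable) countable
  by countable_datatype

instance fm :: (countable) countable
  by countable_datatype

lemma finite_set_tm: "finite (set_tm t)"
  by (induction t) auto

lemma finite_set_fm: "finite (set_fm \<phi>)"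
  by (induction \<phi>) (auto simp: finite_set_tm)

lemma tm_of_symbols: "tm_of L t \<Longrightarrow> set_tm t \<subseteq> funs L"
proof (induction t)
  case (Fn f ts)
  then have "set_tm t \<subseteq> funs L" if "t \<in> set ts" for t
    using that by (auto simp: list_all_iff)
  then show ?case
    using Fn.prems by auto
qed simp

lemma fm_of_symbols: "fm_of L \<phi> \<Longrightarrow> set_fm \<phi> \<subseteq> funs L \<union> rels L"
  by (induction \<phi>) (auto dest: tm_of_symbols[THEN subsetD])

text \<open>A formula is a pattern over the natural numbers, of which there are countably many,
  together with an enumeration of its finitely many symbols. The extra \<open>c\<close> keeps the
  enumerated set nonempty.\<close>

lemma fm_as_sequence:
  assumes "set_fm \<phi> \<subseteq> I"
  shows "\<phi> \<in> (\<lambda>(\<psi>, g). map_fm g \<psi>) ` ((UNIV :: nat fm set) \<times> {g. \<forall>n. g n \<in> insert c I})"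
proof -
  let ?F = "insert c (set_fm \<phi>)"
  define g where "g = from_nat_into ?F"
  have countable: "countable ?F"
    using finite_set_fm[of \<phi>] by (simp add: countable_finite)
  have range: "range g = ?F"
    unfolding g_def by (rule range_from_nat_into[OF _ countable]) simp
  have "map_fm g (map_fm (to_nat_on ?F) \<phi>) = map_fm (\<lambda>x. x) \<phi>"
    unfolding fm.map_comp by (rule fm.map_cong) (use countable in \<open>auto simp: g_def\<close>)
  then have "\<phi> = map_fm g (map_fm (to_nat_on ?F) \<phi>)"
    by (simp add: fm.map_ident)
  moreover have "\<forall>n. g n \<in> insert c I"
    using range assms by blast
  ultimately show ?thesis
    by (intro image_eqI[of _ _ "(map_fm (to_nat_on ?F) \<phi>, g)"]) auto
qed

lemma sat_cong2:
  assumes "\<And>p. p \<in> free_vars2 \<phi> \<Longrightarrow> S p = T p"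
  shows "sat M e S \<phi> = sat M e T \<phi>"
  using assms
proof (induction \<phi> arbitrary: e S T)
  case (All2 n i \<phi>)
  have "sat M e (S((n, i) := R)) \<phi> = sat M e (T((n, i) := R)) \<phi>" for R
    by (rule All2.IH) (use All2.prems in auto)
  then show ?case
    by simp
next
  case (And \<phi> \<psi>)
  have "sat M e S \<phi> = sat M e T \<phi>" "sat M e S \<psi> = sat M e T \<psi>"
    by (rule And.IH; use And.prems in auto)+
  then show ?case
    by simp
next
  case (All x \<phi>)
  have "sat M (e(x := a)) S \<phi> = sat M (e(x := a)) T \<phi>" for a
    by (rule All.IH) (use All.prems in auto)
  then show ?case
    by simp
next
  case (Neg \<phi>)
  have "sat M e S \<phi> = sat M e T \<phi>"
    by (rule Neg.IH) (use Neg.prems in auto)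
  then show ?case
    by simp
qed simp_all

lemma tm_val_in:
  assumes "structure_of L M" "tm_of L t" "range e \<subseteq> points M"
  shows "tm_val M e t \<in> points M"
  using assms(2)
proof (induction t)
  case (Var x)
  then show ?case using assms(3) by auto
next
  case (Fn f ts)
  then have "map (tm_val M e) ts \<in> nlists (fun_arity L f) (points M)"
    by (intro nlistsI) (auto simp: list_all_iff)
  then show ?case
    using Fn.prems assms(1) by (auto simp: structure_of_def)
qed

section \<open>Restricting a structure\<close>

text \<open>Inverse to \<open>elts\<close> where X is a set of the universe, which by Separation
  includes every subset of some \<open>elts a\<close>; arbitrary elsewhere.\<close>

definition code :: "'v set \<Rightarrow> 'v::zfc_universe" where
  "code X = (SOME y. elts y = X)"

lemma elts_code:
  assumes "elts y = X"
  shows "elts (code X) = X"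
  unfolding code_def by (rule someI) (rule assms)

lemma elts_code_subset:
  assumes "X \<subseteq> elts a"
  shows "elts (code X) = X"
proof -
  obtain y where "elts y = {z \<in> elts a. z \<in> X}"
    using separation[of a "\<lambda>z. z \<in> X"] by blast
  then show ?thesis
    using assms by (intro elts_code) auto
qed

text \<open>Functions keep their interpretation even if x is not closed under them. Terms therefore
  have the same value in M and in every restriction, and closure can be treated separately.\<close>

definition restrict_struct :: "'v::zfc_universe language \<Rightarrow> 'v struct \<Rightarrow> 'v set \<Rightarrow> 'v struct" where
  "restrict_struct L M x =
     \<lparr>domain = code x, fun_int = fun_int M,
      rel_int = \<lambda>r. rel_int M r \<inter> nlists (rel_arity L r) x\<rparr>"

lemma tm_val_restrict: "tm_val (restrict_struct L M x) e t = tm_val M e t"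
  by (induction t) (auto simp: restrict_struct_def cong: map_cong)

lemma points_restrict: "x \<subseteq> points M \<Longrightarrow> points (restrict_struct L M x) = x"
  by (simp add: restrict_struct_def elts_code_subset)

lemma substructure_restrict:
  assumes "x \<subseteq> points M" "x \<noteq> {}"
    and "\<forall>f\<in>funs L. \<forall>xs\<in>nlists (fun_arity L f) x. fun_int M f xs \<in> x"
  shows "substructure L (restrict_struct L M x) M"
  unfolding substructure_def structure_of_def points_restrict[OF assms(1)]
  using assms by (simp add: restrict_struct_def)

definition restrict_rels :: "(nat \<times> nat \<Rightarrow> 'v list set) \<Rightarrow> 'v set \<Rightarrow> nat \<times> nat \<Rightarrow> 'v list set" where
  "restrict_rels S x p = S p \<inter> nlists (fst p) x"

section \<open>Normal measures\<close>

locale normal_measure_space =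
  fixes \<kappa> A :: "'v::zfc_universe" and U :: "'v set set set"
  assumes cardinal: "cardinal \<kappa>"
    and uncountable: "uncountable (elts \<kappa>)"
    and nonempty: "elts A \<noteq> {}"
    and normal: "normal_measure \<kappa> A U"
begin

abbreviation "P \<equiv> small_subsets \<kappa> A"

section \<open>The quantifier "for almost every x"\<close>

definition ae :: "('v set \<Rightarrow> bool) \<Rightarrow> bool" where
  "ae Q \<longleftrightarrow> {x \<in> P. Q x} \<in> U"

lemma ultrafilter: "ultrafilter_on P U"
  and complete: "complete_family \<kappa> U"
  and fine: "a \<in> elts A \<Longrightarrow> ae (\<lambda>x. a \<in> x)"
  using normal by (auto simp: normal_measure_def fine_measure_def ae_def)

lemma superset_in_U: "X \<in> U \<Longrightarrow> X \<subseteq> Y \<Longrightarrow> Y \<subseteq> P \<Longrightarrow> Y \<in> U"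
  and Int_in_U: "X \<in> U \<Longrightarrow> Y \<in> U \<Longrightarrow> X \<inter> Y \<in> U"
  and ultra: "X \<subseteq> P \<Longrightarrow> X \<in> U \<or> P - X \<in> U"
  using ultrafilter unfolding ultrafilter_on_def by simp_all

lemma subset_if_P: "x \<in> P \<Longrightarrow> x \<subseteq> elts A"
  by (simp add: small_subsets_def)

lemma nlists_subset: "x \<in> P \<Longrightarrow> nlists n x \<subseteq> nlists n (elts A)"
  by (intro nlists_mono subset_if_P)

lemma ae_mono:
  assumes "ae Q" "\<And>x. x \<in> P \<Longrightarrow> Q x \<Longrightarrow> R x"
  shows "ae R"
proof -
  have "{x \<in> P. Q x} \<subseteq> {x \<in> P. R x}"
    using assms(2) by blast
  then show ?thesis
    using assms(1) superset_in_U unfolding ae_def by blast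
qed

lemma not_ae_False: "\<not> ae (\<lambda>_. False)"
  using ultrafilter by (simp add: ae_def ultrafilter_on_def)

lemma ae_in_P: "ae (\<lambda>x. x \<in> P)"
  using ultrafilter by (simp add: ae_def ultrafilter_on_def)

lemma ae_const_iff [simp]: "ae (\<lambda>_. b) \<longleftrightarrow> b"
  using not_ae_False ae_in_P ae_mono[of "\<lambda>x. x \<in> P" "\<lambda>_. True"] by (cases b) simp_all

lemma ae_conj:
  assumes "ae Q" "ae R"
  shows "ae (\<lambda>x. Q x \<and> R x)"
proof -
  have "{x \<in> P. Q x} \<inter> {x \<in> P. R x} \<in> U"
    using assms unfolding ae_def by (rule Int_in_U)
  moreover have "{x \<in> P. Q x} \<inter> {x \<in> P. R x} = {x \<in> P. Q x \<and> R x}"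
    by blast
  ultimately show ?thesis
    by (simp add: ae_def)
qed

lemma ae_not_iff: "ae (\<lambda>x. \<not> Q x) \<longleftrightarrow> \<not> ae Q"
proof
  assume not: "ae (\<lambda>x. \<not> Q x)"
  show "\<not> ae Q"
  proof
    assume "ae Q"
    from ae_conj[OF this not] show False
      by simp
  qed
next
  assume "\<not> ae Q"
  then have "P - {x \<in> P. Q x} \<in> U"
    using ultra[of "{x \<in> P. Q x}"] unfolding ae_def by blast
  moreover have "P - {x \<in> P. Q x} = {x \<in> P. \<not> Q x}"
    by blast
  ultimately show "ae (\<lambda>x. \<not> Q x)"
    by (simp add: ae_def)
qed

lemma ae_conj_iff: "ae (\<lambda>x. Q x \<and> R x) \<longleftrightarrow> ae Q \<and> ae R"
proof (intro iffI conjI)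
  assume QR: "ae (\<lambda>x. Q x \<and> R x)"
  show "ae Q" "ae R"
    by (rule ae_mono[OF QR]; simp)+
qed (use ae_conj in blast)

lemma ae_cong:
  assumes "\<And>x. x \<in> P \<Longrightarrow> Q x \<longleftrightarrow> R x"
  shows "ae Q \<longleftrightarrow> ae R"
  using ae_mono[of Q R] ae_mono[of R Q] assms by blast

lemma ae_ball:
  assumes "I \<prec> elts \<kappa>" "\<And>i. i \<in> I \<Longrightarrow> ae (Q i)"
  shows "ae (\<lambda>x. \<forall>i\<in>I. Q i x)"
proof (cases "I = {}")
  case True
  then show ?thesis
    using ae_in_P by (auto intro: ae_mono)
next
  case False
  let ?F = "(\<lambda>i. {x \<in> P. Q i x}) ` I"
  have "?F \<prec> elts \<kappa>"
    using image_lepoll assms(1) by (rule lesspoll_trans1)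
  moreover have "?F \<subseteq> U" "?F \<noteq> {}"
    using assms(2) False by (auto simp: ae_def)
  ultimately have "\<Inter>?F \<in> U"
    using complete by (auto simp: complete_family_def)
  moreover have "\<Inter>?F = {x \<in> P. \<forall>i\<in>I. Q i x}"
    using False by auto
  ultimately show ?thesis
    by (simp add: ae_def)
qed

lemma ae_all_countable:
  assumes "\<And>i :: 'i :: countable. ae (Q i)"
  shows "ae (\<lambda>x. \<forall>i. Q i x)"
  using ae_ball[OF countable_lesspoll_uncountable[OF countableI_type uncountable], of UNIV Q] assms
  by simp

section \<open>Normality as an exchange of quantifiers\<close>

text \<open>The conclusion of normality, for functions with values in sets depending on the argument.\<close>

definition pressing :: "('v set \<Rightarrow> 'b set) \<Rightarrow> bool" where
  "pressing Z \<longleftrightarrow> (\<forall>f. ae (\<lambda>x. f x \<in> Z x) \<longrightarrow> (\<exists>b. ae (\<lambda>x. f x = b)))"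

lemma pressing_eq:
  assumes "pressing Z" "ae (\<lambda>x. f x \<in> Z x)"
  obtains b where "ae (\<lambda>x. f x = b)"
  using assms(2) assms(1)[unfolded pressing_def, THEN spec[of _ f]] that by blast

text \<open>The form in which normality is applied: a witness chosen separately for each x may be
  taken to be the same for almost every x.\<close>

lemma pressingD:
  assumes "pressing Z" "ae (\<lambda>x. \<exists>b\<in>Z x. Q b x)"
  obtains b where "ae (\<lambda>x. b \<in> Z x \<and> Q b x)"
proof -
  define f where "f x = (SOME b. b \<in> Z x \<and> Q b x)" for x
  have f: "ae (\<lambda>x. f x \<in> Z x \<and> Q (f x) x)"
    by (rule ae_mono[OF assms(2)]) (auto simp: f_def intro: someI2)
  have "ae (\<lambda>x. f x \<in> Z x)"
    by (rule ae_mono[OF f]) simp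
  then obtain b where b: "ae (\<lambda>x. f x = b)"
    using pressing_eq[OF assms(1)] by meson
  have "ae (\<lambda>x. b \<in> Z x \<and> Q b x)"
    by (rule ae_mono[OF ae_conj[OF f b]]) auto
  then show thesis
    by (rule that)
qed

lemma pressing_self: "pressing (\<lambda>x. x)"
  unfolding pressing_def
proof (intro allI impI)
  fix f assume f: "ae (\<lambda>x. f x \<in> x)"
  obtain a where "a \<in> elts A"
    using nonempty by blast
  \<comment> \<open>Normality is given only for functions from all of P to A, hence the default
    value a off the set where f presses down.\<close>
  then have "(\<lambda>x. if f x \<in> x then f x else a) \<in> P \<rightarrow> elts A" (is "?g \<in> _")
    by (auto simp: small_subsets_def)
  moreover have "ae (\<lambda>x. ?g x \<in> x)"
    by (rule ae_mono[OF f]) simp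
  ultimately obtain b where "ae (\<lambda>x. ?g x = b)"
    using normal[unfolded normal_measure_def, THEN conjunct2, THEN bspec[of _ _ ?g]]
    unfolding ae_def by blast
  then have "ae (\<lambda>x. f x \<in> x \<and> ?g x = b)"
    by (rule ae_conj[OF f])
  then have "ae (\<lambda>x. f x = b)"
    by (rule ae_mono) presburger
  then show "\<exists>b. ae (\<lambda>x. f x = b)"
    by blast
qed

text \<open>This is \<kappa>-completeness: a function avoiding each element of I almost everywhere
  would avoid all of I almost everywhere.\<close>

lemma pressing_const:
  assumes "I \<prec> elts \<kappa>"
  shows "pressing (\<lambda>_. I)"
  unfolding pressing_def
proof (intro allI impI, rule ccontr)
  fix f assume f: "ae (\<lambda>x. f x \<in> I)" and "\<nexists>b. ae (\<lambda>x. f x = b)"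
  then have "ae (\<lambda>x. \<forall>i\<in>I. f x \<noteq> i)"
    by (intro ae_ball[OF assms]) (simp add: ae_not_iff)
  from ae_conj[OF f this] have "ae (\<lambda>x. False)"
    by (rule ae_mono) auto
  then show False
    using not_ae_False by simp
qed

lemma pressing_countable: "countable I \<Longrightarrow> pressing (\<lambda>_. I)"
  using pressing_const countable_lesspoll_uncountable[OF _ uncountable] by blast

text \<open>Each coordinate is constant almost everywhere, and as \<kappa> is uncountable,
  completeness treats the countably many coordinates together.\<close>

lemma pressing_sequences:
  assumes "pressing Z"
  shows "pressing (\<lambda>x. {g :: nat \<Rightarrow> 'b. \<forall>n. g n \<in> Z x})"
  unfolding pressing_def
proof (intro allI impI)
  fix f :: "'v set \<Rightarrow> nat \<Rightarrow> 'b" assume f: "ae (\<lambda>x. f x \<in> {g. \<forall>n. g n \<in> Z x})"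
  have "\<exists>b. ae (\<lambda>x. f x n = b)" for n
  proof -
    have "ae (\<lambda>x. f x n \<in> Z x)"
      by (rule ae_mono[OF f]) simp
    then show ?thesis
      using pressing_eq[OF assms, of "\<lambda>x. f x n"] by blast
  qed
  then obtain g where g: "ae (\<lambda>x. f x n = g n)" for n
    by metis
  have "ae (\<lambda>x. \<forall>n. f x n = g n)"
    by (rule ae_all_countable) (rule g)
  then have "ae (\<lambda>x. f x = g)"
    by (rule ae_mono) auto
  then show "\<exists>g. ae (\<lambda>x. f x = g)"
    by blast
qed

lemma pressing_times:
  assumes "pressing Z" "pressing Y"
  shows "pressing (\<lambda>x. Z x \<times> Y x)"
  unfolding pressing_def
proof (intro allI impI)
  fix f assume f: "ae (\<lambda>x. f x \<in> Z x \<times> Y x)"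
  have "ae (\<lambda>x. fst (f x) \<in> Z x)"
    by (rule ae_mono[OF f]) auto
  then obtain b where b: "ae (\<lambda>x. fst (f x) = b)"
    by (rule pressing_eq[OF assms(1)])
  have "ae (\<lambda>x. snd (f x) \<in> Y x)"
    by (rule ae_mono[OF f]) auto
  then obtain c where c: "ae (\<lambda>x. snd (f x) = c)"
    by (rule pressing_eq[OF assms(2)])
  have "ae (\<lambda>x. f x = (b, c))"
    by (rule ae_mono[OF ae_conj[OF b c]]) auto
  then show "\<exists>b. ae (\<lambda>x. f x = b)"
    by blast
qed

lemma pressing_image:
  assumes "pressing Z" "\<And>x. x \<in> P \<Longrightarrow> Y x \<subseteq> h ` Z x"
  shows "pressing Y"
  unfolding pressing_def
proof (intro allI impI)
  fix f assume f: "ae (\<lambda>x. f x \<in> Y x)"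
  have "ae (\<lambda>x. \<exists>z\<in>Z x. f x = h z)"
    by (rule ae_mono[OF f]) (use assms(2) in blast)
  then obtain z where "ae (\<lambda>x. z \<in> Z x \<and> f x = h z)"
    by (rule pressingD[OF assms(1)])
  then have "ae (\<lambda>x. f x = h z)"
    by (rule ae_mono) simp
  then show "\<exists>b. ae (\<lambda>x. f x = b)"
    by blast
qed

lemma ae_nonempty: "ae (\<lambda>x. x \<noteq> {})"
proof -
  obtain a where "a \<in> elts A"
    using nonempty by blast
  from fine[OF this] show ?thesis
    by (rule ae_mono) auto
qed

lemma pressing_nlists: "pressing (nlists n)"
proof -
  \<comment> \<open>Padding a tuple needs an element of x, so the set of tuples is emptied when x is
    empty. Almost every x is nonempty, which removes the restriction afterwards.\<close>
  have "pressing (\<lambda>x. nlists n x \<inter> {t. x \<noteq> {}})"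
  proof (rule pressing_image[OF pressing_sequences[OF pressing_self]])
    fix x assume "x \<in> P"
    show "nlists n x \<inter> {t. x \<noteq> {}} \<subseteq> (\<lambda>g. map g [0..<n]) ` {g. \<forall>k. g k \<in> x}"
    proof (cases "x = {}")
      case False
      then obtain c where "insert c x = x"
        by blast
      then show ?thesis
        using nlists_as_sequences[of n x c] by auto
    qed simp
  qed
  moreover have "ae (\<lambda>x. f x \<in> nlists n x \<inter> {t. x \<noteq> {}})" if "ae (\<lambda>x. f x \<in> nlists n x)" for f
    by (rule ae_mono[OF ae_conj[OF that ae_nonempty]]) simp
  with calculation show ?thesis
    unfolding pressing_def by simp
qed

section \<open>Limits of relations and the theorem of Los\<close>

lemma ae_subset:
  assumes "countable X" "X \<subseteq> elts A"
  shows "ae (\<lambda>x. X \<subseteq> x)"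
proof -
  have "ae (\<lambda>x. \<forall>a\<in>X. a \<in> x)"
    using countable_lesspoll_uncountable[OF assms(1) uncountable]
    by (rule ae_ball) (use fine assms(2) in auto)
  then show ?thesis
    by (rule ae_mono) auto
qed

text \<open>Turns relations chosen separately on each x into restrictions of one relation on A. This
  handles second-order quantifiers as well as free second-order variables.\<close>

lemma ae_eq_limit:
  assumes R: "ae (\<lambda>x. R x \<subseteq> nlists n x)"
  obtains T where "T \<subseteq> nlists n (elts A)" "ae (\<lambda>x. R x = T \<inter> nlists n x)"
proof -
  define T where "T = {t \<in> nlists n (elts A). ae (\<lambda>x. t \<in> R x)}"
  have "ae (\<lambda>x. R x = T \<inter> nlists n x)"
  proof (rule ccontr)
    assume "\<not> ?thesis"
    then have "ae (\<lambda>x. R x \<noteq> T \<inter> nlists n x)"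
      by (simp add: ae_not_iff)
    then have "ae (\<lambda>x. \<exists>t\<in>nlists n x. (t \<in> R x) \<noteq> (t \<in> T))"
      by (rule ae_mono[OF ae_conj[OF R]]) blast
    then obtain t where t: "ae (\<lambda>x. t \<in> nlists n x \<and> (t \<in> R x) \<noteq> (t \<in> T))"
      by (rule pressingD[OF pressing_nlists])
    \<comment> \<open>A statement not mentioning x holds as soon as it holds for almost every x;
      this pulls facts about the fixed tuple out of \<open>ae\<close>.\<close>
    have "ae (\<lambda>x. t \<in> nlists n (elts A))"
      by (rule ae_mono[OF t]) (use nlists_subset in blast)
    then have in_A: "t \<in> nlists n (elts A)"
      by simp
    have iff: "ae (\<lambda>x. (t \<in> R x) \<noteq> (t \<in> T))"
      by (rule ae_mono[OF t]) simp
    show False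
    proof (cases "t \<in> T")
      case True
      then have "ae (\<lambda>x. \<not> t \<in> R x)"
        using iff by simp
      then show False
        using True unfolding ae_not_iff T_def by simp
    next
      case False
      then have "ae (\<lambda>x. t \<in> R x)"
        using iff by simp
      then show False
        using False in_A unfolding T_def by simp
    qed
  qed
  moreover have "T \<subseteq> nlists n (elts A)"
    by (auto simp: T_def)
  ultimately show thesis
    using that by blast
qed

text \<open>By induction on \<phi>. Fineness and completeness put the finitely many term values into
  almost every x, which settles atomic formulas with a relation; the ultrafilter commutes with the
  connectives. For quantifiers, the direction from M to almost every x uses normality to make
  counterexamples uniform.\<close>

lemma los:
  assumes M: "structure_of L M" "domain M = A"
    and "fm_of L \<phi>" "range e \<subseteq> elts A" "\<And>n i. S (n, i) \<subseteq> nlists n (elts A)"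
  shows "sat M e S \<phi> \<longleftrightarrow> ae (\<lambda>x. sat (restrict_struct L M x) e (restrict_rels S x) \<phi>)"
proof -
  have val: "tm_val (restrict_struct L M x) e = tm_val M e" for x e
    by (rule ext) (rule tm_val_restrict)
  have points: "points (restrict_struct L M x) = x" if "x \<in> P" for x
    using points_restrict[of x M L] subset_if_P[OF that] M(2) by simp
  show ?thesis
    using assms(3-)
  proof (induction \<phi> arbitrary: e S)
    case (Eq s t)
    then show ?case
      by (simp add: tm_val_restrict)
  next
    case (Rel r ts)
    let ?vs = "map (tm_val M e) ts"
    have "set ?vs \<subseteq> elts A"
      using Rel tm_val_in[OF M(1)] M(2) by auto
    then have "ae (\<lambda>x. set ?vs \<subseteq> x)"
      by (intro ae_subset countable_finite) simp_all
    then have "ae (\<lambda>x. ?vs \<in> nlists (rel_arity L r) x)"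
      by (rule ae_mono) (rule nlistsI, use Rel in simp_all)
    then have "?vs \<in> rel_int M r \<longleftrightarrow> ae (\<lambda>x. ?vs \<in> rel_int M r \<and> ?vs \<in> nlists (rel_arity L r) x)"
      unfolding ae_conj_iff by simp
    moreover have "sat (restrict_struct L M x) e (restrict_rels S x) (Rel r ts) \<longleftrightarrow>
        ?vs \<in> rel_int M r \<and> ?vs \<in> nlists (rel_arity L r) x" for x
      by (simp add: val) (simp add: restrict_struct_def)
    ultimately show ?case
      by simp
  next
    case (RelVar i ts)
    let ?vs = "map (tm_val M e) ts"
    have "set ?vs \<subseteq> elts A"
      using RelVar tm_val_in[OF M(1)] M(2) by auto
    then have "ae (\<lambda>x. set ?vs \<subseteq> x)"
      by (intro ae_subset countable_finite) simp_all
    then have "ae (\<lambda>x. ?vs \<in> nlists (length ts) x)"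
      by (rule ae_mono) (rule nlistsI, simp_all)
    then have "?vs \<in> S (length ts, i) \<longleftrightarrow>
        ae (\<lambda>x. ?vs \<in> S (length ts, i) \<and> ?vs \<in> nlists (length ts) x)"
      unfolding ae_conj_iff by simp
    moreover have "sat (restrict_struct L M x) e (restrict_rels S x) (RelVar i ts) \<longleftrightarrow>
        ?vs \<in> S (length ts, i) \<and> ?vs \<in> nlists (length ts) x" for x
      by (simp add: val restrict_rels_def)
    ultimately show ?case
      by simp
  next
    case (Neg \<phi>)
    then show ?case
      by (simp add: ae_not_iff)
  next
    case (And \<phi> \<psi>)
    then show ?case
      by (simp add: ae_conj_iff)
  next
    case (All v \<phi>)
    let ?sat = "\<lambda>a x. sat (restrict_struct L M x) (e(v := a)) (restrict_rels S x) \<phi>"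
    have IH: "sat M (e(v := a)) S \<phi> \<longleftrightarrow> ae (?sat a)" if "a \<in> elts A" for a
      by (rule All.IH) (use All.prems that in auto)
    have "(\<forall>a\<in>elts A. ae (?sat a)) \<longleftrightarrow> ae (\<lambda>x. \<forall>a\<in>x. ?sat a x)"
    proof (intro iffI ballI)
      fix a assume all: "ae (\<lambda>x. \<forall>a\<in>x. ?sat a x)" and "a \<in> elts A"
      then have "ae (\<lambda>x. a \<in> x)"
        by (intro fine)
      then show "ae (?sat a)"
        by (rule ae_mono[OF ae_conj[OF all]]) blast
    next
      assume all: "\<forall>a\<in>elts A. ae (?sat a)"
      show "ae (\<lambda>x. \<forall>a\<in>x. ?sat a x)"
      proof (rule ccontr)
        assume "\<not> ?thesis"
        then have "ae (\<lambda>x. \<exists>a\<in>x. \<not> ?sat a x)"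
          unfolding ae_not_iff[symmetric] by simp
        then obtain a where a: "ae (\<lambda>x. a \<in> x \<and> \<not> ?sat a x)"
          by (rule pressingD[OF pressing_self])
        then have "ae (\<lambda>x. a \<in> elts A)"
          by (rule ae_mono) (use subset_if_P in blast)
        then have "ae (?sat a)"
          using all by simp
        from ae_conj[OF this a] have "ae (\<lambda>_. False)"
          by (rule ae_mono) blast
        then show False
          by simp
      qed
    qed
    then have "sat M e S (All v \<phi>) \<longleftrightarrow> ae (\<lambda>x. \<forall>a\<in>x. ?sat a x)"
      using IH M(2) by simp
    also have "\<dots> \<longleftrightarrow> ae (\<lambda>x. sat (restrict_struct L M x) e (restrict_rels S x) (All v \<phi>))"
      by (rule ae_cong) (simp add: points)
    finally show ?case .
  next
    case (All2 n i \<phi>)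
    let ?sat = "\<lambda>R x. sat (restrict_struct L M x) e ((restrict_rels S x)((n, i) := R)) \<phi>"
    have upd: "restrict_rels (S((n, i) := R)) x = (restrict_rels S x)((n, i) := R \<inter> nlists n x)" for R x
      by (rule ext) (simp add: restrict_rels_def)
    have IH: "sat M e (S((n, i) := R)) \<phi> \<longleftrightarrow> ae (\<lambda>x. ?sat (R \<inter> nlists n x) x)"
      if "R \<subseteq> nlists n (elts A)" for R
      unfolding upd[symmetric] by (rule All2.IH) (use All2.prems that in auto)
    have "(\<forall>R\<subseteq>nlists n (elts A). ae (\<lambda>x. ?sat (R \<inter> nlists n x) x)) \<longleftrightarrow>
        ae (\<lambda>x. \<forall>R\<subseteq>nlists n x. ?sat R x)"
    proof (intro iffI allI impI)
      fix R assume all: "ae (\<lambda>x. \<forall>R\<subseteq>nlists n x. ?sat R x)"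
      then show "ae (\<lambda>x. ?sat (R \<inter> nlists n x) x)"
        by (rule ae_mono) blast
    next
      assume all: "\<forall>R\<subseteq>nlists n (elts A). ae (\<lambda>x. ?sat (R \<inter> nlists n x) x)"
      show "ae (\<lambda>x. \<forall>R\<subseteq>nlists n x. ?sat R x)"
      proof (rule ccontr)
        assume "\<not> ?thesis"
        then have ex: "ae (\<lambda>x. \<exists>R. R \<subseteq> nlists n x \<and> \<not> ?sat R x)"
          unfolding ae_not_iff[symmetric] by simp
        \<comment> \<open>One counterexample is chosen on each x; their limit T contradicts the
          assumption about relations on A.\<close>
        define R where "R x = (SOME R. R \<subseteq> nlists n x \<and> \<not> ?sat R x)" for x
        have R: "ae (\<lambda>x. R x \<subseteq> nlists n x \<and> \<not> ?sat (R x) x)"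
          by (rule ae_mono[OF ex]) (unfold R_def, rule someI_ex)
        have "ae (\<lambda>x. R x \<subseteq> nlists n x)"
          by (rule ae_mono[OF R]) simp
        then obtain T where T: "T \<subseteq> nlists n (elts A)" "ae (\<lambda>x. R x = T \<inter> nlists n x)"
          by (rule ae_eq_limit)
        have "ae (\<lambda>x. ?sat (T \<inter> nlists n x) x)"
          using all T(1) by blast
        from ae_conj[OF this ae_conj[OF R T(2)]] have "ae (\<lambda>_. False)"
          by (rule ae_mono) metis
        then show False
          by simp
      qed
    qed
    then have "sat M e S (All2 n i \<phi>) \<longleftrightarrow> ae (\<lambda>x. \<forall>R\<subseteq>nlists n x. ?sat R x)"
      using IH M(2) by simp
    also have "\<dots> \<longleftrightarrow> ae (\<lambda>x. sat (restrict_struct L M x) e (restrict_rels S x) (All2 n i \<phi>))"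
      by (rule ae_cong) (simp add: points)
    finally show ?case .
  qed
qed

text \<open>Otherwise normality fixes one \<alpha> below \<kappa> that lies in almost every x but is
  not included in it. As \<alpha> has fewer than \<kappa> elements, fineness and completeness put
  all of them into almost every x. Finally, x is smaller than \<kappa>, so its trace on \<kappa> is
  a proper initial segment.\<close>

lemma ae_initial_segment:
  assumes sub: "elts \<kappa> \<subseteq> elts A"
  shows "ae (\<lambda>x. \<exists>\<alpha>\<in>elts \<kappa>. x \<inter> elts \<kappa> = elts \<alpha>)"
proof -
  have ord: "ordinal \<kappa>"
    using cardinal by (simp add: cardinal_def)
  have "ae (\<lambda>x. \<forall>\<alpha>\<in>x. \<alpha> \<in> elts \<kappa> \<longrightarrow> elts \<alpha> \<subseteq> x)"
  proof (rule ccontr)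
    assume "\<not> ?thesis"
    then have "ae (\<lambda>x. \<exists>\<alpha>\<in>x. \<alpha> \<in> elts \<kappa> \<and> \<not> elts \<alpha> \<subseteq> x)"
      unfolding ae_not_iff[symmetric] by simp
    then obtain \<alpha> where "ae (\<lambda>x. \<alpha> \<in> x \<and> \<alpha> \<in> elts \<kappa> \<and> \<not> elts \<alpha> \<subseteq> x)"
      by (rule pressingD[OF pressing_self])
    then have \<alpha>: "\<alpha> \<in> elts \<kappa>" and "ae (\<lambda>x. \<not> elts \<alpha> \<subseteq> x)"
      unfolding ae_conj_iff by simp_all
    then have "elts \<alpha> \<prec> elts \<kappa>" "elts \<alpha> \<subseteq> elts A"
      using cardinal sub by (auto simp: cardinal_def ordinal_def transitive_set_def)
    then have "ae (\<lambda>x. \<forall>\<beta>\<in>elts \<alpha>. \<beta> \<in> x)"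
      using fine by (intro ae_ball) auto
    then show False
      using \<open>ae (\<lambda>x. \<not> elts \<alpha> \<subseteq> x)\<close> unfolding ae_not_iff subset_iff Ball_def by simp
  qed
  then show ?thesis
  proof (rule ae_mono)
    fix x assume x: "x \<in> P" and closed: "\<forall>\<alpha>\<in>x. \<alpha> \<in> elts \<kappa> \<longrightarrow> elts \<alpha> \<subseteq> x"
    have "x \<inter> elts \<kappa> \<prec> elts \<kappa>"
      using x subset_imp_lepoll[of "x \<inter> elts \<kappa>" x] lesspoll_trans1 by (auto simp: small_subsets_def)
    then have "x \<inter> elts \<kappa> \<noteq> elts \<kappa>"
      using lesspoll_not_refl by metis
    moreover have "elts \<beta> \<subseteq> x \<inter> elts \<kappa>" if "\<beta> \<in> x \<inter> elts \<kappa>" for \<beta>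
      using that closed ord by (auto simp: ordinal_def transitive_set_def)
    ultimately show "\<exists>\<alpha>\<in>elts \<kappa>. x \<inter> elts \<kappa> = elts \<alpha>"
      by (intro initial_segment_of_ordinal ord) auto
  qed
qed

section \<open>Reflection into almost every restriction\<close>

context
  fixes L :: "'v language" and M :: "'v struct"
  assumes small_language: "symbols L \<prec> elts \<kappa>"
    and struct: "structure_of L M" and domain: "domain M = A"
begin

lemma range_in_A:
  assumes "ae (\<lambda>x. range (e :: nat \<Rightarrow> 'v) \<subseteq> x)"
  shows "range e \<subseteq> elts A"
proof -
  have "ae (\<lambda>x. range e \<subseteq> elts A)"
    by (rule ae_mono[OF assms]) (use subset_if_P in blast)
  then show ?thesis
    by simp
qed

lemma small_symbols: "funs L \<union> rels L \<prec> elts \<kappa>"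
proof -
  have "funs L \<union> rels L \<subseteq> case_sum id id ` symbols L"
    unfolding symbols_def by force
  then show ?thesis
    using small_language by (meson lesspoll_trans1 subset_image_lepoll)
qed

lemma pressing_funs: "pressing (\<lambda>_. funs L)"
  by (rule pressing_const, rule lesspoll_trans1[OF _ small_symbols], rule subset_imp_lepoll) simp

text \<open>Formulas need not be counted: the conclusion of normality holds for countably many
  patterns and for sequences of symbols, hence for formulas composed of both.\<close>

lemma pressing_formulas: "pressing (\<lambda>_. {\<phi>. fm_of L \<phi>})"
proof -
  obtain c :: 'v where True
    by blast
  have "insert c (funs L \<union> rels L) \<prec> elts \<kappa>"
    using small_symbols uncountable by (rule insert_lesspoll_uncountable)
  then have "pressing (\<lambda>_. (UNIV :: nat fm set) \<times> {g. \<forall>n :: nat. g n \<in> insert c (funs L \<union> rels L)})"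
    by (intro pressing_times pressing_countable pressing_sequences pressing_const) simp_all
  then show ?thesis
  proof (rule pressing_image)
    show "{\<phi>. fm_of L \<phi>} \<subseteq> (\<lambda>(\<psi>, g). map_fm g \<psi>) `
        ((UNIV :: nat fm set) \<times> {g. \<forall>n. g n \<in> insert c (funs L \<union> rels L)})"
      by (rule subsetI, rule fm_as_sequence, rule fm_of_symbols) simp
  qed
qed

text \<open>A failure of closure is made uniform in two rounds, first the symbol and then its
  arguments; but the resulting single value lies in almost every x by fineness.\<close>

lemma ae_closed:
  "ae (\<lambda>x. \<forall>f\<in>funs L. \<forall>xs\<in>nlists (fun_arity L f) x. fun_int M f xs \<in> x)"
proof (rule ccontr)
  assume "\<not> ?thesis"
  then have "ae (\<lambda>x. \<exists>f\<in>funs L. \<exists>xs\<in>nlists (fun_arity L f) x. fun_int M f xs \<notin> x)"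
    unfolding ae_not_iff[symmetric] by simp
  then obtain f where "ae (\<lambda>x. f \<in> funs L \<and> (\<exists>xs\<in>nlists (fun_arity L f) x. fun_int M f xs \<notin> x))"
    by (rule pressingD[OF pressing_funs])
  then have f: "f \<in> funs L" and "ae (\<lambda>x. \<exists>xs\<in>nlists (fun_arity L f) x. fun_int M f xs \<notin> x)"
    unfolding ae_conj_iff by simp_all
  from this(2) obtain xs where xs:
    "ae (\<lambda>x. xs \<in> nlists (fun_arity L f) x \<and> fun_int M f xs \<notin> x)"
    by (rule pressingD[OF pressing_nlists])
  then have "ae (\<lambda>x. xs \<in> nlists (fun_arity L f) (elts A))"
    by (rule ae_mono) (use nlists_subset in blast)
  then have "fun_int M f xs \<in> elts A"
    using struct f domain by (simp add: structure_of_def)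
  then have "ae (\<lambda>x. fun_int M f xs \<in> x)"
    by (rule fine)
  then show False
    using xs unfolding ae_conj_iff ae_not_iff by simp
qed

text \<open>\<open>los\<close> treats one formula and one assignment at a time. To treat all at
  once, a failing formula and then a failing assignment are made independent of x.\<close>

lemma ae_elementary:
  "ae (\<lambda>x. \<forall>\<phi> e S. fm_of L \<phi> \<and> first_order \<phi> \<and> range e \<subseteq> x \<longrightarrow>
      sat (restrict_struct L M x) e S \<phi> = sat M e S \<phi>)"
proof (rule ccontr)
  let ?good = "\<lambda>\<phi> e S x. sat (restrict_struct L M x) e S \<phi> = sat M e S \<phi>"
  \<comment> \<open>First-order formulas do not depend on the second-order assignment, so the empty
    one can replace every S.\<close>
  let ?T = "\<lambda>_. {} :: 'v list set"
  assume "\<not> ?thesis"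
  then have "ae (\<lambda>x. \<exists>\<phi> e S. fm_of L \<phi> \<and> first_order \<phi> \<and> range e \<subseteq> x \<and> \<not> ?good \<phi> e S x)"
    unfolding ae_not_iff[symmetric] by simp
  then have "ae (\<lambda>x. \<exists>\<phi>\<in>{\<phi>. fm_of L \<phi>}. first_order \<phi> \<and>
      (\<exists>e\<in>{e. \<forall>n. e n \<in> x}. \<not> ?good \<phi> e ?T x))"
  proof (rule ae_mono, elim exE conjE)
    fix x \<phi> e S
    assume "fm_of L \<phi>" "range e \<subseteq> x" and fo: "first_order \<phi>" and bad: "\<not> ?good \<phi> e S x"
    moreover have "\<not> ?good \<phi> e ?T x"
      using bad fo sat_cong2[of \<phi> S ?T] by (simp add: first_order_def)
    ultimately show "\<exists>\<phi>\<in>{\<phi>. fm_of L \<phi>}. first_order \<phi> \<and> (\<exists>e\<in>{e. \<forall>n. e n \<in> x}. \<not> ?good \<phi> e ?T x)"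
      by blast
  qed
  then obtain \<phi> where "ae (\<lambda>x. \<phi> \<in> {\<phi>. fm_of L \<phi>} \<and> first_order \<phi> \<and>
      (\<exists>e\<in>{e. \<forall>n. e n \<in> x}. \<not> ?good \<phi> e ?T x))"
    by (rule pressingD[OF pressing_formulas])
  then have \<phi>: "fm_of L \<phi>" and "ae (\<lambda>x. \<exists>e\<in>{e. \<forall>n. e n \<in> x}. \<not> ?good \<phi> e ?T x)"
    unfolding ae_conj_iff by simp_all
  from this(2) obtain e where e: "ae (\<lambda>x. e \<in> {e. \<forall>n. e n \<in> x} \<and> \<not> ?good \<phi> e ?T x)"
    by (rule pressingD[OF pressing_sequences[OF pressing_self]])
  have "ae (\<lambda>x. range e \<subseteq> x)"
    by (rule ae_mono[OF e]) blast
  then have range: "range e \<subseteq> elts A"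
    by (rule range_in_A)
  have "restrict_rels ?T x = ?T" for x
    by (rule ext) (simp add: restrict_rels_def)
  then have los_e: "sat M e ?T \<phi> \<longleftrightarrow> ae (\<lambda>x. sat (restrict_struct L M x) e ?T \<phi>)"
    using los[OF struct domain \<phi> range, of ?T] by simp
  have bad: "ae (\<lambda>x. \<not> ?good \<phi> e ?T x)"
    by (rule ae_mono[OF e]) blast
  show False
  proof (cases "sat M e ?T \<phi>")
    case True
    then show False
      using bad los_e ae_not_iff by simp
  next
    case False
    then show False
      using bad los_e by simp
  qed
qed

text \<open>Truth in a restriction concerns all assignments over x. A failing e is fixed by
  normality, and a failing S is a restriction of one assignment over A, to which \<open>los\<close>
  applies.\<close>

lemma ae_true_in:
  assumes \<phi>: "fm_of L \<phi>" and true: "true_in \<phi> M"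
  shows "ae (\<lambda>x. true_in \<phi> (restrict_struct L M x))"
proof (rule ccontr)
  let ?ok = "\<lambda>S x. \<forall>p. S p \<subseteq> nlists (fst p) x"
  assume "\<not> ?thesis"
  then have "ae (\<lambda>x. \<not> true_in \<phi> (restrict_struct L M x))"
    by (rule ae_not_iff[THEN iffD2])
  then have "ae (\<lambda>x. \<exists>e\<in>{e. \<forall>n. e n \<in> x}. \<exists>S. ?ok S x \<and> \<not> sat (restrict_struct L M x) e S \<phi>)"
  proof (rule ae_mono)
    fix x assume "x \<in> P" and false: "\<not> true_in \<phi> (restrict_struct L M x)"
    have "points (restrict_struct L M x) = x"
      using points_restrict[of x M L] subset_if_P[OF \<open>x \<in> P\<close>] domain by simp
    then have "\<not> (\<forall>e S. range e \<subseteq> x \<and> (\<forall>n i. S (n, i) \<subseteq> nlists n x) \<longrightarrow>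
        sat (restrict_struct L M x) e S \<phi>)"
      using false unfolding true_in_def by simp
    then obtain e S where "range e \<subseteq> x" and S: "\<forall>n i. S (n, i) \<subseteq> nlists n x"
      and bad: "\<not> sat (restrict_struct L M x) e S \<phi>"
      by blast
    from \<open>range e \<subseteq> x\<close> have "e \<in> {e. \<forall>n. e n \<in> x}"
      by blast
    moreover have "?ok S x"
      using S by auto
    ultimately show "\<exists>e\<in>{e. \<forall>n. e n \<in> x}. \<exists>S. ?ok S x \<and> \<not> sat (restrict_struct L M x) e S \<phi>"
      using bad by blast
  qed
  then obtain e where e: "ae (\<lambda>x. e \<in> {e. \<forall>n. e n \<in> x} \<and>
      (\<exists>S. ?ok S x \<and> \<not> sat (restrict_struct L M x) e S \<phi>))"
    by (rule pressingD[OF pressing_sequences[OF pressing_self]])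
  have "ae (\<lambda>x. range e \<subseteq> x)"
    by (rule ae_mono[OF e]) blast
  then have range: "range e \<subseteq> elts A"
    by (rule range_in_A)
  define S where "S x = (SOME S. ?ok S x \<and> \<not> sat (restrict_struct L M x) e S \<phi>)" for x
  have S: "ae (\<lambda>x. ?ok (S x) x \<and> \<not> sat (restrict_struct L M x) e (S x) \<phi>)"
  proof (rule ae_mono[OF e], elim conjE)
    fix x assume "\<exists>S. ?ok S x \<and> \<not> sat (restrict_struct L M x) e S \<phi>"
    then show "?ok (S x) x \<and> \<not> sat (restrict_struct L M x) e (S x) \<phi>"
      unfolding S_def by (rule someI_ex)
  qed
  \<comment> \<open>The limit is taken for each second-order variable p separately; there are
    countably many of these, so almost every x fits all limits.\<close>
  have "\<exists>T. T \<subseteq> nlists (fst p) (elts A) \<and> ae (\<lambda>x. S x p = T \<inter> nlists (fst p) x)" for p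
  proof -
    have "ae (\<lambda>x. S x p \<subseteq> nlists (fst p) x)"
      by (rule ae_mono[OF S]) blast
    then show ?thesis
      by (rule ae_eq_limit) blast
  qed
  then obtain T where T: "\<And>p. T p \<subseteq> nlists (fst p) (elts A)"
    and eq: "\<And>p. ae (\<lambda>x. S x p = T p \<inter> nlists (fst p) x)"
    by metis
  have "ae (\<lambda>x. \<forall>p. S x p = T p \<inter> nlists (fst p) x)"
    by (rule ae_all_countable) (rule eq)
  then have "ae (\<lambda>x. S x = restrict_rels T x)"
    by (rule ae_mono) (auto simp: restrict_rels_def)
  from ae_conj[OF this S] have "ae (\<lambda>x. \<not> sat (restrict_struct L M x) e (restrict_rels T x) \<phi>)"
    by (rule ae_mono) auto
  moreover have "T (n, i) \<subseteq> nlists n (elts A)" for n i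
    using T[of "(n, i)"] by simp
  moreover from this have "sat M e T \<phi>"
    using true range domain unfolding true_in_def by blast
  ultimately show False
    using los[OF struct domain \<phi> range, of T] unfolding ae_not_iff by blast
qed

lemma reflects:
  assumes "elts \<kappa> \<subseteq> elts A" "fm_of L \<phi>" "true_in \<phi> M"
  shows "\<exists>m. elementary_substructure L m M \<and> points m \<prec> elts \<kappa> \<and>
    (\<exists>\<alpha>\<in>elts \<kappa>. points m \<inter> elts \<kappa> = elts \<alpha>) \<and> true_in \<phi> m"
proof -
  let ?m = "restrict_struct L M"
  let ?good = "\<lambda>x. elementary_substructure L (?m x) M \<and> points (?m x) \<prec> elts \<kappa> \<and>
    (\<exists>\<alpha>\<in>elts \<kappa>. points (?m x) \<inter> elts \<kappa> = elts \<alpha>) \<and> true_in \<phi> (?m x)"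
  from ae_conj[OF ae_nonempty ae_conj[OF ae_closed ae_conj[OF ae_elementary
      ae_conj[OF ae_initial_segment[OF assms(1)] ae_true_in[OF assms(2,3)]]]]]
  have "ae ?good"
  proof (rule ae_mono)
    fix x assume x: "x \<in> P" and good: "x \<noteq> {} \<and>
        (\<forall>f\<in>funs L. \<forall>xs\<in>nlists (fun_arity L f) x. fun_int M f xs \<in> x) \<and>
        (\<forall>\<phi> e S. fm_of L \<phi> \<and> first_order \<phi> \<and> range e \<subseteq> x \<longrightarrow>
          sat (?m x) e S \<phi> = sat M e S \<phi>) \<and>
        (\<exists>\<alpha>\<in>elts \<kappa>. x \<inter> elts \<kappa> = elts \<alpha>) \<and> true_in \<phi> (?m x)"
    have sub: "x \<subseteq> points M"
      using x subset_if_P domain by simp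
    have "substructure L (?m x) M"
      using sub good by (intro substructure_restrict) simp_all
    then have "elementary_substructure L (?m x) M"
      unfolding elementary_substructure_def points_restrict[OF sub] using good by blast
    moreover have "x \<prec> elts \<kappa>"
      using x by (simp add: small_subsets_def)
    ultimately show "?good x"
      unfolding points_restrict[OF sub] using good by blast
  qed
  \<comment> \<open>What holds for almost every x holds for some x, as the empty set is not in
    U.\<close>
  then show ?thesis
    using not_ae_False ae_mono[of ?good "\<lambda>_. False"] by blast
qed

end

end

theorem supercompact_imp_second_order_reflective:
  assumes "supercompact \<kappa>"
  shows "second_order_reflective \<kappa>"
  unfolding second_order_reflective_def reflective_for_def
proof (intro allI impI, elim conjE)
  fix L M \<phi>
  assume *: "symbols L \<prec> elts \<kappa>" "structure_of L M" "elts \<kappa> \<subseteq> points M"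
    "sentence_of L \<phi>" "true_in \<phi> M"
  obtain U where "normal_measure \<kappa> (domain M) U"
    using assms subset_imp_lepoll[OF *(3)] by (auto simp: supercompact_def)
  then interpret normal_measure_space \<kappa> "domain M" U
    using assms *(2) by unfold_locales (auto simp: supercompact_def structure_of_def)
  show "\<exists>m. elementary_substructure L m M \<and> points m \<prec> elts \<kappa> \<and>
      (\<exists>\<alpha>\<in>elts \<kappa>. points m \<inter> elts \<kappa> = elts \<alpha>) \<and> true_in \<phi> m"
    by (rule reflects) (use * in \<open>simp_all add: sentence_of_def\<close>)
qed

section \<open>Reflection implies uncountability\<close>

definition unary_structure :: "'v::zfc_universe \<Rightarrow> ('v \<Rightarrow> 'v) \<Rightarrow> 'v struct" where
  "unary_structure D F = \<lparr>domain = D, fun_int = \<lambda>_ xs. F (hd xs), rel_int = \<lambda>_. {}\<rparr>"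

text \<open>The reflected sentence is a tautology; only the small substructure matters. K serves as
  the set of function symbols, all interpreted by F, and must be smaller than \<kappa>; it will be
  empty when \<kappa> has a single element.\<close>

lemma pi11_reflective_closed_subset:
  fixes \<kappa> :: "'v::zfc_universe" and K :: "'v set"
  assumes refl: "pi11_reflective \<kappa>" and nonempty: "elts \<kappa> \<noteq> {}" and K: "K \<prec> elts \<kappa>"
    and F: "\<And>x. x \<in> elts \<kappa> \<Longrightarrow> F x \<in> elts \<kappa>"
  obtains m where "m \<subseteq> elts \<kappa>" "m \<noteq> {}" "m \<prec> elts \<kappa>" "K \<noteq> {} \<Longrightarrow> (\<And>x. x \<in> m \<Longrightarrow> F x \<in> m)"
proof -
  define L :: "'v language" where
    "L = \<lparr>funs = K, rels = {}, fun_arity = \<lambda>_. 1, rel_arity = \<lambda>_. 0\<rparr>"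
  let ?M = "unary_structure \<kappa> F"
  let ?\<phi> = "All 0 (Eq (Var 0) (Var 0)) :: 'v fm"
  have "symbols L \<subseteq> Inl ` K"
    by (auto simp: symbols_def L_def)
  then have "symbols L \<lesssim> K"
    by (rule subset_image_lepoll)
  then have "symbols L \<prec> elts \<kappa>"
    using K by (rule lesspoll_trans1)
  moreover have "structure_of L ?M"
    using nonempty F by (auto simp: structure_of_def unary_structure_def L_def in_nlists_Suc_iff)
  moreover have "elts \<kappa> \<subseteq> points ?M"
    by (simp add: unary_structure_def)
  moreover have "sentence_of L ?\<phi>" "true_in ?\<phi> ?M"
    by (simp_all add: sentence_of_def true_in_def)
  moreover have "pi11 ?\<phi>"
    by (rule pi11.matrix) simp
  ultimately obtain m where m: "elementary_substructure L m ?M" "points m \<prec> elts \<kappa>"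
    using refl unfolding pi11_reflective_def reflective_for_def by blast
  then have sub: "substructure L m ?M"
    by (simp add: elementary_substructure_def)
  then have struct: "structure_of L m" and "points m \<subseteq> elts \<kappa>"
    by (simp_all add: substructure_def unary_structure_def)
  moreover have "F x \<in> points m" if "K \<noteq> {}" "x \<in> points m" for x
  proof -
    obtain f where f: "f \<in> funs L"
      using \<open>K \<noteq> {}\<close> by (auto simp: L_def)
    have x: "[x] \<in> nlists (fun_arity L f) (points m)"
      using that by (simp add: L_def)
    then have "fun_int m f [x] \<in> points m"
      using struct f by (simp add: structure_of_def)
    moreover have "fun_int m f [x] = F x"
      using sub f x by (simp add: substructure_def unary_structure_def)
    ultimately show ?thesis
      by simp
  qed
  ultimately show thesis
    using that m(2) by (simp add: structure_of_def)
qed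

text \<open>The witness is the successor map, cyclic if the set is finite.\<close>

lemma countable_closed_subset_equipollent:
  assumes "countable X"
  obtains F where "\<And>x. x \<in> X \<Longrightarrow> F x \<in> X"
    and "\<And>Y. Y \<subseteq> X \<Longrightarrow> Y \<noteq> {} \<Longrightarrow> (\<And>x. x \<in> Y \<Longrightarrow> F x \<in> Y) \<Longrightarrow> X \<lesssim> Y"
proof (cases "finite X")
  case True
  let ?n = "card X"
  obtain h where h: "bij_betw h X {0..<?n}"
    using True ex_bij_betw_finite_nat by blast
  define g where "g = inv_into X h"
  have g: "g k \<in> X" "h (g k) = k" if "k < ?n" for k
    using h that bij_betw_inv_into_right[OF h, of k] bij_betwE[OF bij_betw_inv_into[OF h]]
    by (auto simp: g_def)
  have gh: "g (h x) = x" "h x < ?n" if "x \<in> X" for x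
    using bij_betw_inv_into_left[OF h that] bij_betwE[OF h] that by (auto simp: g_def)
  define F where "F x = g (Suc (h x) mod ?n)" for x
  show thesis
  proof (rule that)
    fix x assume "x \<in> X"
    then show "F x \<in> X"
      unfolding F_def using gh(2)[of x] by (intro g(1)) simp
  next
    fix Y assume Y: "Y \<subseteq> X" "Y \<noteq> {}" and closed: "\<And>x. x \<in> Y \<Longrightarrow> F x \<in> Y"
    then obtain x where x: "x \<in> Y" "x \<in> X"
      by blast
    have orbit: "g ((h x + j) mod ?n) \<in> Y" for j
    proof (induction j)
      case 0
      then show ?case
        using x gh[of x] by simp
    next
      case (Suc j)
      have "0 < ?n"
        using gh(2)[OF x(2)] by simp
      then have "F (g ((h x + j) mod ?n)) = g ((h x + Suc j) mod ?n)"
        by (simp add: F_def g(2) mod_Suc_eq)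
      then show ?case
        using closed[OF Suc] by simp
    qed
    have "X \<subseteq> Y"
    proof
      fix y assume "y \<in> X"
      \<comment> \<open>The number of steps that lead from x around the cycle to y; the subtraction
        is exact because \<open>h x\<close> is below the cardinality.\<close>
      then have "(h x + (?n - h x + h y)) mod ?n = h y"
        using gh(2)[of y] gh(2)[of x] x(2) by simp
      then show "y \<in> Y"
        using orbit[of "?n - h x + h y"] gh(1)[OF \<open>y \<in> X\<close>] by simp
    qed
    then show "X \<lesssim> Y"
      by (rule subset_imp_lepoll)
  qed
next
  case False
  obtain h where h: "bij_betw h X (UNIV :: nat set)"
    using assms False to_nat_on_infinite by blast
  define g where "g = inv_into X h"
  have g: "g k \<in> X" "h (g k) = k" for k
    using h bij_betw_inv_into_right[OF h, of k] bij_betwE[OF bij_betw_inv_into[OF h]]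
    by (auto simp: g_def)
  show thesis
  proof (rule that[of "\<lambda>x. g (Suc (h x))"])
    fix Y assume Y: "Y \<subseteq> X" "Y \<noteq> {}" and closed: "\<And>x. x \<in> Y \<Longrightarrow> g (Suc (h x)) \<in> Y"
    \<comment> \<open>The successor of an element of Y with the largest index would lie in Y
      too.\<close>
    have "infinite Y"
    proof
      assume fin: "finite Y"
      then have "Max (h ` Y) \<in> h ` Y"
        using Y by (intro Max_in) auto
      then obtain x where "x \<in> Y" "h x = Max (h ` Y)"
        by auto
      then have "Suc (Max (h ` Y)) \<in> h ` Y"
        using closed[of x] g(2) by (metis imageI)
      then show False
        using fin Max_ge[of "h ` Y"] by fastforce
    qed
    then have "(UNIV :: nat set) \<lesssim> Y"
      by (simp add: infinite_le_lepoll)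
    moreover have "X \<lesssim> (UNIV :: nat set)"
      using h by (auto simp: lepoll_def bij_betw_def)
    ultimately show "X \<lesssim> Y"
      using lepoll_trans by blast
  qed (rule g)
qed

text \<open>A countable \<kappa> carries an F whose nonempty closed subsets all have the size of
  \<kappa>, while reflection yields a smaller one. If \<kappa> has one element, the language has no
  room for a function symbol, but a smaller nonempty subset is already absurd.\<close>

lemma pi11_reflective_uncountable:
  assumes refl: "pi11_reflective \<kappa>" and nonempty: "elts \<kappa> \<noteq> {}"
  shows "uncountable (elts \<kappa>)"
proof
  assume "countable (elts \<kappa>)"
  then obtain F where F: "\<And>x. x \<in> elts \<kappa> \<Longrightarrow> F x \<in> elts \<kappa>"
    and closed: "\<And>Y. Y \<subseteq> elts \<kappa> \<Longrightarrow> Y \<noteq> {} \<Longrightarrow> (\<And>x. x \<in> Y \<Longrightarrow> F x \<in> Y) \<Longrightarrow> elts \<kappa> \<lesssim> Y"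
    by (rule countable_closed_subset_equipollent) blast
  have False if "\<exists>c. elts \<kappa> = {c}"
  proof -
    have "{} \<prec> elts \<kappa>"
      using nonempty eqpoll_sym[of "{}" "elts \<kappa>"] by (auto simp: lesspoll_def)
    from pi11_reflective_closed_subset[where F = F, OF refl nonempty this F]
    obtain m where "m \<subseteq> elts \<kappa>" "m \<noteq> {}" "m \<prec> elts \<kappa>"
      by metis
    then have "m = elts \<kappa>"
      using that by (metis subset_singletonD)
    then show False
      using \<open>m \<prec> elts \<kappa>\<close> by simp
  qed
  moreover have False if *: "\<nexists>c. elts \<kappa> = {c}"
  proof -
    obtain c where "c \<in> elts \<kappa>"
      using nonempty by blast
    then have "{c} \<lesssim> elts \<kappa>"
      by (intro subset_imp_lepoll) simp
    then have "{c} \<prec> elts \<kappa>"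
      using * eqpoll_singleton_iff[of "elts \<kappa>" c] eqpoll_sym[of "{c}" "elts \<kappa>"]
      by (auto simp: lesspoll_def)
    from pi11_reflective_closed_subset[where F = F, OF refl nonempty this F]
    obtain m where m: "m \<subseteq> elts \<kappa>" "m \<noteq> {}" "m \<prec> elts \<kappa>" "\<And>x. x \<in> m \<Longrightarrow> F x \<in> m"
      by (metis insert_not_empty)
    have "elts \<kappa> \<prec> elts \<kappa>"
      using closed[OF m(1,2,4)] m(3) by (rule lesspoll_trans1)
    then show False
      by simp
  qed
  ultimately show False
    by blast
qed

section \<open>Reflection implies supercompactness\<close>

text \<open>\<open>E q u\<close> is to mean that the family coded by u has the member coded by q,
  and \<open>Q q\<close> that q codes a subset. That each set of such codes is coded quantifies
  universally over a relation R and is otherwise first-order, so it passes to m together with the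
  operations in \<open>Fs\<close>.\<close>

lemma pi11_reflective_coding:
  fixes \<kappa> D :: "'v::zfc_universe" and Fs :: "('v \<Rightarrow> 'v \<Rightarrow> 'v) list"
  assumes refl: "pi11_reflective \<kappa>" and inf: "infinite (elts \<kappa>)"
    and D: "elts \<kappa> \<subseteq> elts D"
    and Fs: "\<And>F a b. F \<in> set Fs \<Longrightarrow> a \<in> elts D \<Longrightarrow> b \<in> elts D \<Longrightarrow> F a b \<in> elts D"
    and coded: "\<And>R. R \<subseteq> elts D \<Longrightarrow> \<exists>u\<in>elts D. \<forall>q\<in>elts D. E q u \<longleftrightarrow> Q q \<and> q \<in> R"
  shows "\<exists>m. m \<subseteq> elts D \<and> m \<prec> elts \<kappa> \<and> (\<exists>\<alpha>\<in>elts \<kappa>. m \<inter> elts \<kappa> = elts \<alpha>) \<and>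
    (\<forall>F\<in>set Fs. \<forall>a\<in>m. \<forall>b\<in>m. F a b \<in> m) \<and>
    (\<forall>R\<subseteq>m. \<exists>u\<in>m. \<forall>q\<in>m. E q u \<longleftrightarrow> Q q \<and> q \<in> R)"
proof -
  \<comment> \<open>Symbols are elements of the universe, so distinct names are drawn from an
    injective sequence. Functions and relations are kept apart and may share names.\<close>
  obtain g :: "nat \<Rightarrow> 'v" where g: "inj g"
    using inf infinite_countable_subset by blast
  define L :: "'v language" where
    "L = \<lparr>funs = g ` {..<length Fs}, rels = {g 0, g 1}, fun_arity = \<lambda>_. 2,
      rel_arity = \<lambda>r. if r = g 0 then 2 else 1\<rparr>"
  define M :: "'v struct" where
    "M = \<lparr>domain = D, fun_int = \<lambda>f xs. (Fs ! inv g f) (xs ! 0) (xs ! 1),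
      rel_int = \<lambda>r. if r = g 0 then {[q, u] | q u. q \<in> elts D \<and> u \<in> elts D \<and> E q u}
        else {[q] | q. q \<in> elts D \<and> Q q}\<rparr>"
  have g01: "g (Suc 0) \<noteq> g 0"
    using g by (simp add: inj_eq)
  let ?E = "Rel (g 0) [Var 1, Var 0]" and ?QR = "And (Rel (g 1) [Var 1]) (RelVar 0 [Var 1])"
  \<comment> \<open>For every R there is u (\<open>Var 0\<close>) such that for all q
    (\<open>Var 1\<close>) \<open>?E\<close> is equivalent to \<open>?QR\<close>, written with
    \<open>Neg\<close> and \<open>And\<close> only.\<close>
  define \<phi> where "\<phi> = All2 1 0 (Neg (All 0 (Neg (All 1
    (And (Neg (And ?E (Neg ?QR))) (Neg (And ?QR (Neg ?E))))))))"
  have "finite (symbols L)"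
    by (simp add: symbols_def L_def)
  then have "symbols L \<prec> elts \<kappa>"
    by (rule finite_lesspoll_infinite[OF inf])
  moreover have "structure_of L M"
    using inf D Fs g by (auto simp: structure_of_def L_def M_def numeral_2_eq_2 in_nlists_Suc_iff)
  moreover have "elts \<kappa> \<subseteq> points M"
    using D by (simp add: M_def)
  moreover have "sentence_of L \<phi>"
    by (auto simp: sentence_of_def \<phi>_def L_def g01)
  moreover have "pi11 \<phi>"
    unfolding \<phi>_def by (intro pi11.all2 pi11.matrix) simp
  moreover have sat_\<phi>: "sat N e S \<phi> \<longleftrightarrow> (\<forall>R\<subseteq>nlists 1 (points N). \<exists>u\<in>points N. \<forall>q\<in>points N.
      [q, u] \<in> rel_int N (g 0) \<longleftrightarrow> [q] \<in> rel_int N (g 1) \<and> [q] \<in> R)" for N e S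
    unfolding \<phi>_def by simp (intro all_cong bex_cong ball_cong refl; argo)
  moreover have "true_in \<phi> M"
    unfolding true_in_def sat_\<phi>
  proof (intro allI impI)
    fix R :: "'v list set"
    obtain u where "u \<in> elts D" "\<forall>q\<in>elts D. E q u \<longleftrightarrow> Q q \<and> q \<in> {q \<in> elts D. [q] \<in> R}"
      using coded[of "{q \<in> elts D. [q] \<in> R}"] by blast
    then show "\<exists>u\<in>points M. \<forall>q\<in>points M.
        [q, u] \<in> rel_int M (g 0) \<longleftrightarrow> [q] \<in> rel_int M (g 1) \<and> [q] \<in> R"
      using g01 by (intro bexI[of _ u]) (auto simp: M_def)
  qed
  ultimately obtain m where m: "elementary_substructure L m M" "points m \<prec> elts \<kappa>"
      "\<exists>\<alpha>\<in>elts \<kappa>. points m \<inter> elts \<kappa> = elts \<alpha>" "true_in \<phi> m"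
    using refl[unfolded pi11_reflective_def reflective_for_def, rule_format, of L M \<phi>] by blast
  have sub: "substructure L m M"
    using m(1) by (simp add: elementary_substructure_def)
  then have struct: "structure_of L m" and points: "points m \<subseteq> elts D"
    by (simp_all add: substructure_def M_def)
  show ?thesis
  proof (intro exI[of _ "points m"] conjI ballI allI impI)
    fix F a b assume "F \<in> set Fs" and ab: "a \<in> points m" "b \<in> points m"
    then obtain i where i: "i < length Fs" "Fs ! i = F"
      by (auto simp: in_set_conv_nth)
    have xs: "[a, b] \<in> nlists (fun_arity L (g i)) (points m)"
      using ab by (simp add: L_def numeral_2_eq_2)
    have f: "g i \<in> funs L"
      using i by (simp add: L_def)
    have "fun_int m (g i) [a, b] \<in> points m"
      using struct f xs by (simp add: structure_of_def)
    moreover have "fun_int m (g i) [a, b] = fun_int M (g i) [a, b]"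
      using sub f xs by (simp add: substructure_def)
    ultimately show "F a b \<in> points m"
      using g i by (simp add: M_def)
  next
    fix R assume R: "R \<subseteq> points m"
    have "points m \<noteq> {}"
      using struct by (simp add: structure_of_def)
    then obtain c where "c \<in> points m"
      by blast
    then have sat: "sat m (\<lambda>_. c) (\<lambda>_. {}) \<phi>"
      using m(4)[unfolded true_in_def, rule_format, of "\<lambda>_. c" "\<lambda>_. {}"] by auto
    have R1: "(\<lambda>q. [q]) ` R \<subseteq> nlists 1 (points m)"
      using R by auto
    obtain u where u: "u \<in> points m" "\<forall>q\<in>points m.
        [q, u] \<in> rel_int m (g 0) \<longleftrightarrow> [q] \<in> rel_int m (g 1) \<and> [q] \<in> (\<lambda>q. [q]) ` R"
      using sat_\<phi>[THEN iffD1, OF sat, THEN spec, THEN mp, OF R1] by (elim bexE)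
    have rels: "rel_int m (g 0) = rel_int M (g 0) \<inter> nlists 2 (points m)"
      "rel_int m (g 1) = rel_int M (g 1) \<inter> nlists 1 (points m)"
      using sub g01 by (simp_all add: substructure_def L_def)
    have "[q, u] \<in> rel_int m (g 0) \<longleftrightarrow> E q u" "[q] \<in> rel_int m (g 1) \<longleftrightarrow> Q q"
      if "q \<in> points m" for q
      using that u(1) points g01 unfolding rels by (auto simp: M_def numeral_2_eq_2)
    then have "\<forall>q\<in>points m. E q u \<longleftrightarrow> Q q \<and> q \<in> R"
      using u(2) by auto
    then show "\<exists>u\<in>points m. \<forall>q\<in>points m. E q u \<longleftrightarrow> Q q \<and> q \<in> R"
      using u(1) by blast
  qed (use m points in auto)
qed

section \<open>Coding subsets and families of subsets\<close>

lemma ex_elts_Un: "\<exists>z. elts z = elts x \<union> elts y"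
proof -
  obtain p where "elts p = {x, y}"
    using pairing by blast
  then show ?thesis
    using union[of p] by simp
qed

lemma ex_elts_Pow_code:
  assumes "\<C> \<subseteq> Pow (elts a)"
  shows "\<exists>z. elts z = code ` \<C>"
proof -
  obtain p where p: "elts p = {z. elts z \<subseteq> elts a}"
    using power_set by blast
  have "elts (code x) = x" if "x \<in> \<C>" for x
    using assms that by (intro elts_code_subset) blast
  then have "code ` \<C> \<subseteq> elts p"
    using assms p by auto
  then show ?thesis
    using elts_code_subset by blast
qed

lemma inj_on_code: "inj_on code (Pow (elts a))"
  by (rule inj_on_inverseI[of _ elts]) (simp add: elts_code_subset)

text \<open>Two power sets above the set of codes of members of P suffice: the first contains the
  codes of subsets of P, the second the codes of families of these.\<close>

lemma subset_family_coding:
  fixes A B :: "'v::zfc_universe" and P :: "'v set set"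
  assumes P: "P \<subseteq> Pow (elts A)"
  obtains D :: 'v and enc :: "'v set set \<Rightarrow> 'v" and dec :: "'v \<Rightarrow> 'v set set set"
  where "elts B \<subseteq> elts D" "elts A \<subseteq> elts D"
    "inj_on enc (Pow P)" "\<And>X. X \<subseteq> P \<Longrightarrow> enc X \<in> elts D"
    "\<And>\<U>. \<U> \<subseteq> Pow P \<Longrightarrow> \<exists>u\<in>elts D. dec u = \<U>"
proof -
  obtain p where p: "elts p = code ` P"
    using ex_elts_Pow_code[OF P] by blast
  obtain p2 where p2: "elts p2 = {z. elts z \<subseteq> elts p}"
    using power_set by blast
  obtain p3 where p3: "elts p3 = {z. elts z \<subseteq> elts p2}"
    using power_set by blast
  define enc where "enc X = code (code ` X)" for X :: "'v set set"
  define dec where "dec u = {X. X \<subseteq> P \<and> enc X \<in> elts u}" for u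
  obtain d1 where d1: "elts d1 = elts A \<union> elts B"
    using ex_elts_Un by blast
  obtain d2 where d2: "elts d2 = elts p2 \<union> elts p3"
    using ex_elts_Un by blast
  obtain D where D: "elts D = elts d1 \<union> elts d2"
    using ex_elts_Un by blast
  have enc: "elts (enc X) = code ` X" if "X \<subseteq> P" for X
    unfolding enc_def by (rule elts_code_subset[of _ p]) (use p that in blast)
  have inj: "inj_on code P"
    using inj_on_code P by (rule inj_on_subset)
  have inj_enc: "inj_on enc (Pow P)"
  proof (rule inj_onI)
    fix X Y assume XY: "X \<in> Pow P" "Y \<in> Pow P" "enc X = enc Y"
    then have "code ` X = code ` Y"
      using enc[of X] enc[of Y] by simp
    then show "X = Y"
      using inj_on_image_eq_iff[OF inj] XY by blast
  qed
  have enc_p2: "enc X \<in> elts p2" if "X \<subseteq> P" for X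
    using enc[OF that] p p2 that by auto
  show thesis
  proof (rule that[of D enc dec, OF _ _ inj_enc])
    show "elts B \<subseteq> elts D" "elts A \<subseteq> elts D"
      using D d1 by auto
    show "enc X \<in> elts D" if "X \<subseteq> P" for X
      using enc_p2[OF that] D d2 by blast
  next
    fix \<U> assume \<U>: "\<U> \<subseteq> Pow P"
    have "enc ` \<U> \<subseteq> elts p2"
      using \<U> enc_p2 by blast
    then have u: "elts (code (enc ` \<U>)) = enc ` \<U>"
      by (rule elts_code_subset)
    have "enc X \<in> enc ` \<U> \<longleftrightarrow> X \<in> \<U>" if "X \<subseteq> P" for X
      using \<U> that by (intro inj_on_image_mem_iff[OF inj_enc]) simp_all
    then have "dec (code (enc ` \<U>)) = \<U>"
      using \<U> unfolding dec_def u by blast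
    moreover have "code (enc ` \<U>) \<in> elts D"
      using u \<open>enc ` \<U> \<subseteq> elts p2\<close> p3 D d2 by auto
    ultimately show "\<exists>u\<in>elts D. dec u = \<U>"
      by blast
  qed
qed

text \<open>Conditions fitted to the reflection argument. Completeness concerns families indexed by
  an ordinal below \<kappa>, because a substructure with an ordinal as its trace on \<kappa>
  contains all indices along with \<gamma>.\<close>

lemma normal_measureI:
  fixes \<kappa> A :: "'v::zfc_universe"
  defines "P \<equiv> small_subsets \<kappa> A"
  assumes card: "cardinal \<kappa>" and inf: "infinite (elts \<kappa>)"
    and U: "U \<subseteq> Pow P" and P: "P \<in> U" and empty: "{} \<notin> U"
    and superset: "\<And>X Y. X \<in> U \<Longrightarrow> X \<subseteq> Y \<Longrightarrow> Y \<subseteq> P \<Longrightarrow> Y \<in> U"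
    and ultra: "\<And>Z. Z \<subseteq> P \<Longrightarrow> Z \<in> U \<or> P - Z \<in> U"
    and complete: "\<And>\<gamma> h. \<gamma> \<in> elts \<kappa> \<Longrightarrow> elts \<gamma> \<noteq> {} \<Longrightarrow> h ` elts \<gamma> \<subseteq> U \<Longrightarrow> \<Inter> (h ` elts \<gamma>) \<in> U"
    and fine: "\<And>a. a \<in> elts A \<Longrightarrow> {x \<in> P. a \<in> x} \<in> U"
    and normal: "\<And>f. f \<in> P \<rightarrow> elts A \<Longrightarrow> {x \<in> P. f x \<in> x} \<in> U \<Longrightarrow>
      \<exists>a\<in>elts A. {x \<in> P. f x = a} \<in> U"
  shows "normal_measure \<kappa> A U"
proof -
  have Inter: "\<Inter>\<F> \<in> U" if \<F>: "\<F> \<subseteq> U" "\<F> \<noteq> {}" "\<F> \<prec> elts \<kappa>" for \<F>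
  proof -
    have "ordinal \<kappa>"
      using card by (simp add: cardinal_def)
    then obtain \<gamma> where \<gamma>: "\<gamma> \<in> elts \<kappa>" "\<F> \<lesssim> elts \<gamma>"
      using lesspoll_ordinal \<F>(3) by blast
    then obtain g where g: "\<F> \<subseteq> g ` elts \<gamma>"
      unfolding lepoll_iff by blast
    obtain X where X: "X \<in> \<F>"
      using \<F>(2) by blast
    \<comment> \<open>Values of g outside the family are replaced by a member X, so that the image
      is exactly the family.\<close>
    define h where "h \<xi> = (if g \<xi> \<in> \<F> then g \<xi> else X)" for \<xi>
    have h: "h ` elts \<gamma> = \<F>"
    proof
      show "h ` elts \<gamma> \<subseteq> \<F>"
        using X by (auto simp: h_def)
      show "\<F> \<subseteq> h ` elts \<gamma>"
      proof
        fix Y assume Y: "Y \<in> \<F>"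
        then obtain \<xi> where "\<xi> \<in> elts \<gamma>" "Y = g \<xi>"
          using g by blast
        then show "Y \<in> h ` elts \<gamma>"
          using Y by (intro image_eqI[of _ _ \<xi>]) (simp_all add: h_def)
      qed
    qed
    then show ?thesis
      using complete[OF \<gamma>(1), of h] \<F>(1,2) by (metis image_is_empty)
  qed
  have "X \<inter> Y \<in> U" if "X \<in> U" "Y \<in> U" for X Y
  proof -
    have "{X, Y} \<prec> elts \<kappa>"
      by (rule finite_lesspoll_infinite[OF inf]) simp
    then show ?thesis
      using Inter[of "{X, Y}"] that by simp
  qed
  then have "ultrafilter_on P U"
    unfolding ultrafilter_on_def using U P empty superset ultra by (intro conjI ballI allI impI) auto
  moreover have "complete_family \<kappa> U"
    unfolding complete_family_def using Inter by blast
  ultimately have "fine_measure \<kappa> A U"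
    using fine by (simp add: fine_measure_def P_def)
  then show ?thesis
    using normal by (simp add: normal_measure_def P_def)
qed

text \<open>Skolemizes the failure of \<open>normal_measureI\<close>: the witnesses become functions
  of U, which can be made operations of a structure.\<close>

lemma normal_measure_counterexample:
  fixes \<kappa> A :: "'v::zfc_universe"
  assumes card: "cardinal \<kappa>" and inf: "infinite (elts \<kappa>)" and P: "P = small_subsets \<kappa> A"
    and no: "\<nexists>U. normal_measure \<kappa> A U"
  obtains X Y Z \<gamma> h a f where "\<And>U. \<not> U \<subseteq> Pow P \<or> P \<notin> U \<or> {} \<in> U \<or>
      (X U \<in> U \<and> X U \<subseteq> Y U \<and> Y U \<subseteq> P \<and> Y U \<notin> U) \<or>
      (Z U \<subseteq> P \<and> Z U \<notin> U \<and> P - Z U \<notin> U) \<or>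
      (\<gamma> U \<in> elts \<kappa> \<and> elts (\<gamma> U) \<noteq> {} \<and> h U ` elts (\<gamma> U) \<subseteq> U \<and> \<Inter> (h U ` elts (\<gamma> U)) \<notin> U) \<or>
      (a U \<in> elts A \<and> {x \<in> P. a U \<in> x} \<notin> U) \<or>
      ({x \<in> P. f U x \<in> x} \<in> U \<and> (\<forall>a\<in>elts A. {x \<in> P. f U x = a} \<notin> U))"
proof -
  let ?B = "\<lambda>U X Y Z \<gamma> h a f. \<not> U \<subseteq> Pow P \<or> P \<notin> U \<or> {} \<in> U \<or>
      (X \<in> U \<and> X \<subseteq> Y \<and> Y \<subseteq> P \<and> Y \<notin> U) \<or> (Z \<subseteq> P \<and> Z \<notin> U \<and> P - Z \<notin> U) \<or>
      (\<gamma> \<in> elts \<kappa> \<and> elts \<gamma> \<noteq> {} \<and> h ` elts \<gamma> \<subseteq> U \<and> \<Inter> (h ` elts \<gamma>) \<notin> U) \<or>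
      (a \<in> elts A \<and> {x \<in> P. a \<in> x} \<notin> U) \<or>
      ({x \<in> P. f x \<in> x} \<in> U \<and> (\<forall>a\<in>elts A. {x \<in> P. f x = a} \<notin> U))"
  have "\<forall>U. \<exists>X Y Z \<gamma> h a f. ?B U X Y Z \<gamma> h a f"
  proof (rule allI, rule ccontr)
    fix U assume "\<nexists>X Y Z \<gamma> h a f. ?B U X Y Z \<gamma> h a f"
    then have "normal_measure \<kappa> A U"
      unfolding P by (intro normal_measureI card inf) (simp_all, metis+)
    then show False
      using no by blast
  qed
  then have "\<exists>X Y Z \<gamma> h a f. \<forall>U. ?B U (X U) (Y U) (Z U) (\<gamma> U) (h U) (a U) (f U)"
    unfolding choice_iff .
  then obtain X Y Z \<gamma> h a f where all: "\<forall>U. ?B U (X U) (Y U) (Z U) (\<gamma> U) (h U) (a U) (f U)"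
    by (elim exE) (rule that)
  show thesis
    by (rule that[of X Y Z \<gamma> h a f]) (rule all[THEN spec])
qed

theorem pi11_reflective_imp_supercompact:
  fixes \<kappa> :: "'v::zfc_universe"
  assumes card: "cardinal \<kappa>" and nonempty: "elts \<kappa> \<noteq> {}" and refl: "pi11_reflective \<kappa>"
  shows "supercompact \<kappa>"
  unfolding supercompact_def
proof (intro conjI card allI impI)
  show unc: "uncountable (elts \<kappa>)"
    using refl nonempty by (rule pi11_reflective_uncountable)
  then have inf: "infinite (elts \<kappa>)"
    using countable_finite by blast
  fix A :: 'v
  show "\<exists>U. normal_measure \<kappa> A U"
  proof (rule ccontr)
    assume no: "\<nexists>U. normal_measure \<kappa> A U"
    define P where "P = small_subsets \<kappa> A"
    have P_sub: "P \<subseteq> Pow (elts A)"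
      by (auto simp: P_def small_subsets_def)
    obtain X Y Z \<gamma> h a f where bad: "\<And>U. \<not> U \<subseteq> Pow P \<or> P \<notin> U \<or> {} \<in> U \<or>
        (X U \<in> U \<and> X U \<subseteq> Y U \<and> Y U \<subseteq> P \<and> Y U \<notin> U) \<or>
        (Z U \<subseteq> P \<and> Z U \<notin> U \<and> P - Z U \<notin> U) \<or>
        (\<gamma> U \<in> elts \<kappa> \<and> elts (\<gamma> U) \<noteq> {} \<and> h U ` elts (\<gamma> U) \<subseteq> U \<and> \<Inter> (h U ` elts (\<gamma> U)) \<notin> U) \<or>
        (a U \<in> elts A \<and> {x \<in> P. a U \<in> x} \<notin> U) \<or>
        ({x \<in> P. f U x \<in> x} \<in> U \<and> (\<forall>a\<in>elts A. {x \<in> P. f U x = a} \<notin> U))"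
      by (rule normal_measure_counterexample[OF card inf P_def no]) (rule that)
    obtain D :: 'v and enc dec where \<kappa>_D: "elts \<kappa> \<subseteq> elts D" and A_D: "elts A \<subseteq> elts D"
      and inj: "inj_on enc (Pow P)" and enc_D: "\<And>X. X \<subseteq> P \<Longrightarrow> enc X \<in> elts D"
      and dec: "\<And>\<U>. \<U> \<subseteq> Pow P \<Longrightarrow> \<exists>u\<in>elts D. dec u = \<U>"
      using subset_family_coding[OF P_sub, of \<kappa>] by blast
    define V where "V u = dec u \<inter> Pow P" for u
    obtain d where d: "d \<in> elts D"
      using nonempty \<kappa>_D by blast
    \<comment> \<open>Operations of a structure must be total on D; the default d is used only where
      the intended value is outside D.\<close>
    define clip where "clip F = (\<lambda>u b. if F u b \<in> elts D then F u b else d)" for F :: "'v \<Rightarrow> 'v \<Rightarrow> 'v"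
    \<comment> \<open>The parameter u codes a family. The parameter b is used twice: as an index
      into the family h, and as a prospective constant value of f.\<close>
    let ?ops = "[\<lambda>u b. enc P, \<lambda>u b. enc {}, \<lambda>u b. enc (X (V u)), \<lambda>u b. enc (Y (V u)),
      \<lambda>u b. enc (Z (V u)), \<lambda>u b. enc (P - Z (V u)), \<lambda>u b. \<gamma> (V u), \<lambda>u b. enc (h (V u) b),
      \<lambda>u b. enc (\<Inter> (h (V u) ` elts (\<gamma> (V u)))), \<lambda>u b. a (V u), \<lambda>u b. enc {x \<in> P. a (V u) \<in> x},
      \<lambda>u b. enc {x \<in> P. f (V u) x \<in> x}, \<lambda>u b. enc {x \<in> P. f (V u) x = b}]"
    have clip_D: "F u b \<in> elts D" if F: "F \<in> set (map clip ?ops)" and "u \<in> elts D" "b \<in> elts D" for F u b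
    proof -
      obtain G where "F = clip G"
        using F unfolding set_map by (elim imageE)
      then show ?thesis
        using d by (simp add: clip_def)
    qed
    have coded: "\<exists>u\<in>elts D. \<forall>q\<in>elts D. q \<in> enc ` V u \<longleftrightarrow> q \<in> enc ` Pow P \<and> q \<in> R"
      if "R \<subseteq> elts D" for R
    proof -
      obtain u where "u \<in> elts D" "dec u = {X. X \<subseteq> P \<and> enc X \<in> R}"
        using dec[of "{X. X \<subseteq> P \<and> enc X \<in> R}"] by blast
      then show ?thesis
        by (intro bexI[of _ u]) (auto simp: V_def)
    qed
    have "\<exists>m. m \<subseteq> elts D \<and> m \<prec> elts \<kappa> \<and> (\<exists>\<alpha>\<in>elts \<kappa>. m \<inter> elts \<kappa> = elts \<alpha>) \<and>
        (\<forall>F\<in>set (map clip ?ops). \<forall>u\<in>m. \<forall>b\<in>m. F u b \<in> m) \<and>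
        (\<forall>R\<subseteq>m. \<exists>u\<in>m. \<forall>q\<in>m. q \<in> enc ` V u \<longleftrightarrow> q \<in> enc ` Pow P \<and> q \<in> R)"
      by (rule pi11_reflective_coding[OF refl inf \<kappa>_D]) (erule (2) clip_D, erule coded)
    then obtain m where m_small: "m \<prec> elts \<kappa>"
      and m_\<kappa>: "\<exists>\<alpha>\<in>elts \<kappa>. m \<inter> elts \<kappa> = elts \<alpha>"
      and closed: "\<forall>F\<in>set (map clip ?ops). \<forall>u\<in>m. \<forall>b\<in>m. F u b \<in> m"
      and m_coded: "\<forall>R\<subseteq>m. \<exists>u\<in>m. \<forall>q\<in>m. q \<in> enc ` V u \<longleftrightarrow> q \<in> enc ` Pow P \<and> q \<in> R"
      by (elim exE conjE) (rule that)
    \<comment> \<open>On the subsets coded in m, the family below is to act as the principal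
      ultrafilter at s.\<close>
    define s where "s = m \<inter> elts A"
    have s: "s \<in> P"
      using m_small subset_imp_lepoll[of s m] lesspoll_trans1[of s m]
      by (auto simp: P_def s_def small_subsets_def)
    let ?R = "enc ` {X. X \<subseteq> P \<and> s \<in> X} \<inter> m"
    obtain u where u: "u \<in> m" and coded_u: "\<forall>q\<in>m. q \<in> enc ` V u \<longleftrightarrow> q \<in> enc ` Pow P \<and> q \<in> ?R"
      using m_coded[THEN spec, of ?R] by auto
    define U where "U = V u"
    have U: "U \<subseteq> Pow P"
      by (simp add: U_def V_def)
    \<comment> \<open>Only codes in m are controlled; this is why every set occurring in a witness
      has an operation producing its code.\<close>
    have mem: "X \<in> U \<longleftrightarrow> s \<in> X" if "X \<subseteq> P" "enc X \<in> m" for X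
    proof -
      have "enc X \<in> enc ` \<X> \<longleftrightarrow> X \<in> \<X>" if "\<X> \<subseteq> Pow P" for \<X>
        by (rule inj_on_image_mem_iff[OF inj]) (use \<open>X \<subseteq> P\<close> that in auto)
      from this[OF U] this[of "{X. X \<subseteq> P \<and> s \<in> X}"] show ?thesis
        using coded_u[rule_format, OF that(2)] that unfolding U_def by auto
    qed
    have op: "G u b \<in> m" if "G \<in> set ?ops" "G u b \<in> elts D" "b \<in> m" for G b
    proof -
      have "clip G u b \<in> m"
        by (rule closed[THEN bspec, THEN bspec, THEN bspec]) (use that u in auto)
      then show ?thesis
        using that(2) by (simp add: clip_def)
    qed
    consider "P \<notin> U" | "{} \<in> U"
      | "X U \<in> U" "X U \<subseteq> Y U" "Y U \<subseteq> P" "Y U \<notin> U"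
      | "Z U \<subseteq> P" "Z U \<notin> U" "P - Z U \<notin> U"
      | "\<gamma> U \<in> elts \<kappa>" "elts (\<gamma> U) \<noteq> {}" "h U ` elts (\<gamma> U) \<subseteq> U" "\<Inter> (h U ` elts (\<gamma> U)) \<notin> U"
      | "a U \<in> elts A" "{x \<in> P. a U \<in> x} \<notin> U"
      | "{x \<in> P. f U x \<in> x} \<in> U" "\<forall>a\<in>elts A. {x \<in> P. f U x = a} \<notin> U"
      using bad[of U] U by argo
    then show False
    proof cases
      case 1
      have "enc P \<in> m"
        using op[of "\<lambda>u b. enc P" u] enc_D[of P] u by simp
      then show False
        using mem[of P] s 1 by simp
    next
      case 2
      have "enc {} \<in> m"
        using op[of "\<lambda>u b. enc {}" u] enc_D[of "{}"] u by simp
      then show False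
        using mem[of "{}"] 2 by simp
    next
      case 3
      have "X U \<subseteq> P"
        using 3 by blast
      then have "enc (X U) \<in> m" "enc (Y U) \<in> m"
        using op[of "\<lambda>u b. enc (X (V u))" u] op[of "\<lambda>u b. enc (Y (V u))" u] enc_D 3(3) u
        by (simp_all add: U_def)
      then show False
        using mem[of "X U"] mem[of "Y U"] \<open>X U \<subseteq> P\<close> 3 by blast
    next
      case 4
      have "enc (Z U) \<in> m" "enc (P - Z U) \<in> m"
        using op[of "\<lambda>u b. enc (Z (V u))" u] op[of "\<lambda>u b. enc (P - Z (V u))" u]
          enc_D[of "Z U"] enc_D[of "P - Z U"] 4(1) u
        by (simp_all add: U_def Diff_subset)
      then show False
        using mem[of "Z U"] mem[of "P - Z U"] s 4 by blast
    next
      case 5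
      let ?I = "\<Inter> (h U ` elts (\<gamma> U))"
      have "\<gamma> U \<in> elts D"
        using 5(1) \<kappa>_D by blast
      then have "\<gamma> U \<in> m"
        using op[of "\<lambda>u b. \<gamma> (V u)" u] u by (simp add: U_def)
      \<comment> \<open>Here it matters that the trace of m on \<kappa> is an ordinal: it contains
        with \<open>\<gamma> U\<close> all its elements, hence m contains the codes of all sets in
        the intersection.\<close>
      moreover obtain \<alpha> where \<alpha>: "\<alpha> \<in> elts \<kappa>" "m \<inter> elts \<kappa> = elts \<alpha>"
        using m_\<kappa> by blast
      ultimately have "\<gamma> U \<in> elts \<alpha>"
        using 5(1) by blast
      then have "elts (\<gamma> U) \<subseteq> elts \<alpha>"
        using card \<alpha>(1) by (auto simp: cardinal_def ordinal_def transitive_set_def)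
      then have \<gamma>_m: "elts (\<gamma> U) \<subseteq> m"
        using \<alpha>(2) by blast
      have sub: "h U \<xi> \<subseteq> P" if "\<xi> \<in> elts (\<gamma> U)" for \<xi>
        using that 5(3) U by blast
      have "s \<in> h U \<xi>" if \<xi>: "\<xi> \<in> elts (\<gamma> U)" for \<xi>
      proof -
        have "\<xi> \<in> m"
          using \<gamma>_m \<xi> by blast
        then have "enc (h U \<xi>) \<in> m"
          using op[of "\<lambda>u b. enc (h (V u) b)" \<xi>] enc_D[OF sub[OF \<xi>]] by (simp add: U_def)
        then show ?thesis
          using mem[OF sub[OF \<xi>]] 5(3) \<xi> by blast
      qed
      then have "s \<in> ?I"
        by blast
      moreover have "?I \<subseteq> P"
        using sub 5(2) by blast
      moreover from this have "enc ?I \<in> m"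
        using op[of "\<lambda>u b. enc (\<Inter> (h (V u) ` elts (\<gamma> (V u))))" u] enc_D[of ?I] u by (simp add: U_def)
      ultimately show False
        using mem[of ?I] 5(4) by blast
    next
      case 6
      let ?X = "{x \<in> P. a U \<in> x}"
      have "a U \<in> elts D"
        using 6(1) A_D by blast
      then have "a U \<in> m"
        using op[of "\<lambda>u b. a (V u)" u] u by (simp add: U_def)
      then have "s \<in> ?X"
        using s 6(1) by (simp add: s_def)
      moreover have "enc ?X \<in> m"
        using op[of "\<lambda>u b. enc {x \<in> P. a (V u) \<in> x}" u] enc_D[of ?X] u by (simp add: U_def)
      ultimately show False
        using mem[of ?X] 6(2) by blast
    next
      case 7
      let ?X = "{x \<in> P. f U x \<in> x}" and ?b = "f U s"
      let ?Y = "{x \<in> P. f U x = ?b}"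
      have "enc ?X \<in> m"
        using op[of "\<lambda>u b. enc {x \<in> P. f (V u) x \<in> x}" u] enc_D[of ?X] u by (simp add: U_def)
      then have "s \<in> ?X"
        using mem[of ?X] 7(1) by blast
      \<comment> \<open>Since the value of f at s lies in s, it lies in m and can itself be used as
        a parameter. The set where f takes this value is then coded in m and contains s.\<close>
      then have b: "?b \<in> m" "?b \<in> elts A"
        by (simp_all add: s_def)
      then have "enc ?Y \<in> m"
        using op[of "\<lambda>u b. enc {x \<in> P. f (V u) x = b}" ?b] enc_D[of ?Y] by (simp add: U_def)
      then show False
        using mem[of ?Y] 7(2) b(2) s by blast
    qed
  qed
qed

theorem corollary26:
  fixes \<kappa> :: "'v::zfc_universe"
  assumes "cardinal \<kappa>" and "elts \<kappa> \<noteq> {}"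
  shows "(second_order_reflective \<kappa> \<longleftrightarrow> pi11_reflective \<kappa>) \<and>
         (pi11_reflective \<kappa> \<longleftrightarrow> supercompact \<kappa>)"
proof -
  have "second_order_reflective \<kappa> \<Longrightarrow> pi11_reflective \<kappa>"
    by (simp add: second_order_reflective_def pi11_reflective_def reflective_for_def)
  then show ?thesis
    using pi11_reflective_imp_supercompact[OF assms] supercompact_imp_second_order_reflective
    by blast
qed

end
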